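(* Let $\ell$ and $n$ be nonnegative integers and let $a,q$ be nonzero complex numbers such that no zero factor appears in any denominator occurring in the identity below. Fix square roots $\sqrt q=q^{1/2}$ and $\sqrt a$. Then $$\sum_{k=0}^{n}(a;q^3)_k\,\frac{(q^{-n};q)_k\,(q^{n-\ell}a;q)_k}{(q;q)_k(\sqrt a;q)_k(-\sqrt a;q)_k(\sqrt{q^{1-2\ell}a};q)_k(-\sqrt{qa};q)_k}\,q^k$$ $$=\frac{(q^{n-\ell}a;q)_\ell\,(q^{\frac12+n-\ell}\sqrt a;q)_\ell}{(q^{2n-\ell}a;q)_\ell\,(q^{\frac12-\ell}\sqrt a;q)_\ell}\sum_{i=0}^{\ell}a^{\frac{2n-5i}{6}}\,q^{(\frac52+\ell)i}\,\frac{1-q^{2n-2i}a}{1-q^{2n}a}\,\frac{(q^{-\ell};q)_i(q^{-n};q)_i(q^{-2n}/a;q)_i}{(q;q)_i(q^{1+\ell-2n}/a;q)_i(q^{1-n}/a;q)_i}\cdot\frac{(q;q^3)_{\frac{n-i}{3}}(q^2;q^3)_{\frac{n-i}{3}}}{(qa;q^3)_{\frac{n-i}{3}}(q^2a;q^3)_{\frac{n-i}{3}}}\,\chi(n-i).$$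
   Context: For complex $x,q$ and an integer $m$, the $q$-shifted factorial is $(x;q)_m=\prod_{j=0}^{m-1}(1-xq^j)$ for $m>0$, $(x;q)_0=1$, and $(x;q)_m=1/\prod_{j=m}^{-1}(1-xq^j)$ for $m<0$; $(x;q^3)_m$ is the same with $q$ replaced by $q^3$. For an integer $N$, $\chi(N)=1$ if $3\mid N$ and $\chi(N)=0$ otherwise; a summand containing $\chi(n-i)=0$ is understood to be $0$, so only indices $i$ with $(n-i)/3\in\mathbb Z$ contribute. Branches of roots are chosen consistently: with the fixed $q^{1/2}$ and $\sqrt a$, one sets $\sqrt{qa}=q^{1/2}\sqrt a$, $\sqrt{q^{1-2\ell}a}=q^{1/2-\ell}\sqrt a$, half-integer powers of $q$ are integer powers of $q^{1/2}$, and $a^{(2n-5i)/6}=(\sqrt a)^{(2n-5i)/3}$, where $(2n-5i)/3$ is an integer whenever $3\mid n-i$. *)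

theory Defs
  imports Complex_Main
begin

text \<open>
  The \<open>q\<close>-shifted factorial with an integer index. If a factor of the product vanishes for a
  negative index, the value is \<open>0\<close> by the convention for division; hence
  \<open>qpoch x q m \<noteq> 0\<close> says, for either sign of \<open>m\<close>, that no factor is zero.
\<close>

definition qpoch :: "complex \<Rightarrow> complex \<Rightarrow> int \<Rightarrow> complex" where
  "qpoch x q m =
     (if m \<ge> 0 then \<Prod>j\<in>{0..m - 1}. (1 - x * q powi j)
      else 1 / (\<Prod>j\<in>{m..-1}. (1 - x * q powi j)))"

definition chi :: "int \<Rightarrow> complex" where
  "chi N = (if 3 dvd N then 1 else 0)"

end

theory Submission
  imports Defs "HOL-Analysis.Analysis"
begin

text \<open>
  Everything rests on the terminating very-well-poised \<open>\<^sub>6\<phi>\<^sub>5\<close> sum. In base \<open>q\<^sup>3\<close> with numerator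
  parameters \<open>q\<^bsup>-k\<^esup>, q\<^bsup>1-k\<^esup>, q\<^bsup>2-k\<^esup>\<close> it expands \<open>(a;q\<^sup>3)\<^sub>k / (a;q)\<^bsub>2k\<^esub>\<close> in the functions
  \<open>(q\<^bsup>-k\<^esup>;q)\<^bsub>3r\<^esub> / (aq;q)\<^bsub>k+3r\<^esub>\<close>. Inserting this in the left-hand side for \<open>l = 0\<close> and exchanging the sums, the
  inner sum is a \<open>q\<close>-Chu--Vandermonde sum that vanishes unless \<open>3r = n\<close>; this is the case \<open>l = 0\<close>.
  For general \<open>l\<close>, the \<open>\<^sub>6\<phi>\<^sub>5\<close> sum in base \<open>q\<close> writes
  \<open>(q\<^bsup>-n\<^esup>;q)\<^sub>k (q\<^bsup>n-l\<^esup>a;q)\<^sub>k / (q\<^bsup>1/2-l\<^esup>\<surd>a;q)\<^sub>k\<close> as a combination over \<open>i\<close> of the same expressions with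
  \<open>l = 0\<close> and \<open>n - i\<close> in place of \<open>n\<close>, and the case \<open>l = 0\<close> applies to each summand.
  These steps divide by factors \<open>1 - a q\<^sup>j\<close> that the identity itself does not contain. They only
  exclude countably many \<open>\<surd>a\<close>, and both sides are continuous in \<open>\<surd>a\<close> where their own denominators
  do not vanish.
\<close>

section \<open>Finite q-shifted factorials with natural index\<close>

text \<open>The algebra up to \<open>cubic_transformation_generic\<close> works over any field;
  \<open>qpoch_nat\<close> links this version to \<open>qpoch\<close>.\<close>

definition qp :: "'a::field \<Rightarrow> 'a \<Rightarrow> nat \<Rightarrow> 'a" where
  "qp x q n = (\<Prod>j<n. 1 - x * q ^ j)"

lemma qp_0 [simp]: "qp x q 0 = 1"
  by (simp add: qp_def)

lemma qp_Suc: "qp x q (Suc n) = qp x q n * (1 - x * q ^ n)"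
  by (simp add: qp_def)

lemma qp_add: "qp x q (m + n) = qp x q m * qp (x * q ^ m) q n"
  by (induction n) (simp_all add: qp_Suc power_add mult_ac)

lemma qp_Suc_left: "qp x q (Suc n) = (1 - x) * qp (x * q) q n"
  using qp_add[of x q 1 n] by (simp add: qp_Suc)

lemma qp_eq_0_iff: "qp x q n = 0 \<longleftrightarrow> (\<exists>j<n. x * q ^ j = 1)"
  by (auto simp: qp_def)

text \<open>Sorts the exponents by residue modulo 3. This turns the three base q^3 factorials of the
  cubic series into one in base q.\<close>

lemma qp_triple:
  "qp x q (3 * r) = qp x (q ^ 3) r * qp (x * q) (q ^ 3) r * qp (x * q ^ 2) (q ^ 3) r"
proof (induction r)
  case (Suc r)
  have "3 * Suc r = Suc (Suc (Suc (3 * r)))"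
    by simp
  then show ?case
    using Suc by (simp only: qp_Suc power_mult power_Suc mult.assoc power2_eq_square)
      (simp only: mult_ac)
qed simp

text \<open>For t^2 = a and s^2 = q this merges four factorials in the denominator of the case l = 0
  into (a;q)_(2k). In the step, differences of squares give exactly the new factors with exponents
  2k and 2k + 1.\<close>

lemma qp_quadruple:
  "qp t (s ^ 2) k * qp (- t) (s ^ 2) k * qp (s * t) (s ^ 2) k * qp (- (s * t)) (s ^ 2) k
   = qp (t ^ 2) (s ^ 2) (2 * k)"
proof (induction k)
  case (Suc k)
  have *: "2 * Suc k = Suc (Suc (2 * k))"
    by simp
  define y where "y = (s ^ 2) ^ k"
  have y2: "(s ^ 2) ^ (2 * k) = y ^ 2"
    by (simp add: y_def power_mult [symmetric] mult_ac)
  have "(1 - t * y) * (1 - (- t) * y) * (1 - s * t * y) * (1 - (- (s * t)) * y)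
      = (1 - t ^ 2 * y ^ 2) * (1 - t ^ 2 * (s ^ 2 * y ^ 2))"
    by algebra
  then have "qp t (s\<^sup>2) k * qp (- t) (s\<^sup>2) k * qp (s * t) (s\<^sup>2) k * qp (- (s * t)) (s\<^sup>2) k *
      ((1 - t * y) * (1 - (- t) * y) * (1 - s * t * y) * (1 - (- (s * t)) * y)) =
      qp (t\<^sup>2) (s\<^sup>2) (2 * k) * ((1 - t ^ 2 * y ^ 2) * (1 - t ^ 2 * (s ^ 2 * y ^ 2)))"
    by (simp only: Suc.IH)
  then show ?case
    unfolding * qp_Suc power_Suc y2 y_def [symmetric] by (simp only: mult_ac)
qed simp

lemma qp_divide_power:
  fixes q :: "'a::field"
  assumes "q \<noteq> 0"
  shows "qp (u / q ^ i) q i = (\<Prod>j<i. 1 - u / q ^ Suc j)"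
proof -
  have "qp (u / q ^ i) q i = (\<Prod>j<i. 1 - u / q ^ i * q ^ (i - Suc j))"
    unfolding qp_def by (rule prod.nat_diff_reindex [symmetric])
  also have "\<dots> = (\<Prod>j<i. 1 - u / q ^ Suc j)"
  proof (rule prod.cong)
    fix j assume "j \<in> {..<i}"
    then have "q ^ i = q ^ (i - Suc j) * q ^ Suc j"
      by (simp add: power_add [symmetric] del: power_Suc)
    then show "1 - u / q ^ i * q ^ (i - Suc j) = 1 - u / q ^ Suc j"
      using assms by simp
  qed simp
  finally show ?thesis .
qed

text \<open>Since 1 - x/Q = -(x/Q) (1 - Q/x), reversal gives (x q^(-i);q)_i = (-x)^i q^(-i(i+1)/2)
  (q/x;q)_i. Comparing this for x and y removes the sign and the power of q.\<close>

lemma qp_reflect: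
  assumes "q \<noteq> 0" "x \<noteq> 0" "y \<noteq> 0"
  shows "qp (x / q ^ i) q i * qp (q / y) q i * y ^ i = qp (y / q ^ i) q i * qp (q / x) q i * x ^ i"
proof -
  have pw: "u ^ i = (\<Prod>j<i. u)" for u :: 'a
    by simp
  show ?thesis
    unfolding qp_divide_power [OF assms(1)] pw [of x] pw [of y] unfolding qp_def prod.distrib [symmetric]
  proof (rule prod.cong)
    fix j assume "j \<in> {..<i}"
    have "(1 - x / Q) * (1 - Q / y) * y = (1 - y / Q) * (1 - Q / x) * x" if "Q \<noteq> 0" for Q
      using assms that by (simp add: divide_simps) algebra
    from this[of "q ^ Suc j"]
    show "(1 - x / q ^ Suc j) * (1 - q / y * q ^ j) * y = (1 - y / q ^ Suc j) * (1 - q / x * q ^ j) * x"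
      using assms by simp
  qed simp
qed

section \<open>The terminating very-well-poised 6-phi-5 sum\<close>

text \<open>
  The summand of the very-well-poised \<open>\<^sub>6\<phi>\<^sub>5\<close> series in base \<open>p\<close>, without the usual
  normalising factor \<open>1 / (1 - a)\<close>.
\<close>

definition vwp :: "'a::field \<Rightarrow> 'a \<Rightarrow> 'a \<Rightarrow> 'a \<Rightarrow> 'a \<Rightarrow> nat \<Rightarrow> 'a" where
  "vwp a b c d p i = qp a p i * (1 - a * p ^ (2 * i)) * qp b p i * qp c p i * qp d p i /
     (qp p p i * qp (a * p / b) p i * qp (a * p / c) p i * qp (a * p / d) p i) *
     (a * p / (b * c * d)) ^ i"

lemma vwp_rotate: "vwp a b c d p i = vwp a c d b p i"
  by (simp add: vwp_def mult_ac)

text \<open>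
  A contiguous relation with a telescoping certificate. It replaces only \<open>d\<close> by \<open>d / p\<close>, so the same
  relation drives both an induction on \<open>N\<close> for \<open>d = p\<^bsup>-N\<^esup>\<close> and, in base \<open>q\<^sup>3\<close>, an induction on
  \<open>k\<close> for the triple \<open>q\<^bsup>-k\<^esup>, q\<^bsup>1-k\<^esup>, q\<^bsup>2-k\<^esup>\<close>, where \<open>q\<^bsup>2-k\<^esup>\<close> turns into \<open>q\<^bsup>-(k+1)\<^esup>\<close>.
\<close>

lemma vwp_telescope:
  fixes a b c d p :: "'a::field"
  assumes nz: "b \<noteq> 0" "c \<noteq> 0" "d \<noteq> 0" "p \<noteq> 0"
    and "qp p p M \<noteq> 0" "qp (a * p / b) p M \<noteq> 0" "qp (a * p / c) p M \<noteq> 0"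
      "qp (a * p / d) p (Suc M) \<noteq> 0"
  shows "(1 - a * p / (b * d)) * (1 - a * p / (c * d)) * (\<Sum>i\<le>M. vwp a b c (d / p) p i) -
     (1 - a * p / d) * (1 - a * p / (b * c * d)) * (\<Sum>i\<le>M. vwp a b c d p i) =
     qp a p (Suc M) * qp b p (Suc M) * qp c p (Suc M) * qp d p M /
     (qp p p M * qp (a * p / b) p M * qp (a * p / c) p M * qp (a * p ^ 2 / d) p M) *
     (a * p / (b * c * d)) ^ Suc M"
proof -
  \<comment> \<open>With e and the argument z as parameters, a = b c e z and every denominator
    parameter becomes a monomial, so the certificate reduces to a polynomial identity.\<close>
  define e where "e = d / p"
  define z where "z = a * p / (b * c * d)"
  have d: "d = e * p" and a: "a = b * c * e * z"
    using nz by (simp_all add: e_def z_def)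
  have e: "e \<noteq> 0"
    using nz by (simp add: e_def)
  have e': "d / p = e" "a * p / b = c * e * z * p" "a * p / c = b * e * z * p" "a * p / d = b * c * z"
      "a * p / (b * d) = c * z" "a * p / (c * d) = b * z" "a * p / (b * c * d) = z"
      "a * p / (b * c * (d / p)) = z * p" "a * p / e = b * c * z * p" "a * p ^ 2 / d = b * c * z * p"
    using nz e by (simp_all add: d a power2_eq_square)
  define G where "G M = qp a p (Suc M) * qp b p (Suc M) * qp c p (Suc M) * qp d p M /
     (qp p p M * qp (c * e * z * p) p M * qp (b * e * z * p) p M * qp (b * c * z * p) p M) * z ^ Suc M" for M
  have ve: "vwp a b c e p i = qp a p i * (1 - a * p ^ (2 * i)) * qp b p i * qp c p i * qp e p i /
     (qp p p i * qp (c * e * z * p) p i * qp (b * e * z * p) p i * qp (b * c * z * p) p i) * (z * p) ^ i" for i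
    unfolding vwp_def e' by (simp add: e' (8) [unfolded e'(1)])
  have vd: "vwp a b c d p i = qp a p i * (1 - a * p ^ (2 * i)) * qp b p i * qp c p i * qp d p i /
     (qp p p i * qp (c * e * z * p) p i * qp (b * e * z * p) p i * qp (b * c * z) p i) * z ^ i" for i
    unfolding vwp_def e' by simp
  have "(1 - c * z) * (1 - b * z) * (\<Sum>i\<le>M. vwp a b c e p i) -
     (1 - b * c * z) * (1 - z) * (\<Sum>i\<le>M. vwp a b c d p i) = G M"
    using assms(5-) unfolding e'
  proof (induction M)
    case 0
    then show ?case
      by (simp add: ve vd G_def qp_Suc) algebra
  next
    case (Suc M)
    define y where "y = p ^ Suc M"
    have yM: "p * p ^ M = y"
      by (simp add: y_def)
    have y2: "p ^ (2 * Suc M) = y ^ 2"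
      by (simp add: y_def power_mult [symmetric] mult_ac del: power_Suc)
    define E where "E = (1 - y) * (1 - c * e * z * y) * (1 - b * e * z * y)"
    \<comment> \<open>As d = e p, peeling off the first factor relates the parameters of the two
      series; both new summands then become explicit multiples of \<open>G M\<close>.\<close>
    have s56: "qp (b * c * z) p (Suc M) = (1 - b * c * z) * qp (b * c * z * p) p M"
      "qp e p (Suc M) = (1 - e) * qp d p M"
      by (simp_all only: qp_Suc_left d)
    have s': "qp p p (Suc M) = qp p p M * (1 - y)"
      "qp (c * e * z * p) p (Suc M) = qp (c * e * z * p) p M * (1 - c * e * z * y)"
      "qp (b * e * z * p) p (Suc M) = qp (b * e * z * p) p M * (1 - b * e * z * y)"
      "qp (b * c * z * p) p (Suc M) = qp (b * c * z * p) p M * (1 - b * c * z * y)"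
      "qp d p (Suc M) = qp d p M * (1 - e * y)"
      by (simp_all only: qp_Suc yM [symmetric] d mult.assoc)
    note s = s'(1-4) s56 s'(5)
    have s2: "qp (b * c * z) p (Suc (Suc M)) = (1 - b * c * z) * qp (b * c * z * p) p M * (1 - b * c * z * y)"
      by (simp only: qp_Suc [of _ _ "Suc M"] s(5) y_def)
    have nz: "qp p p M \<noteq> 0" "qp (c * e * z * p) p M \<noteq> 0" "qp (b * e * z * p) p M \<noteq> 0"
      "qp (b * c * z * p) p M \<noteq> 0" "E \<noteq> 0" "1 - b * c * z \<noteq> 0" "1 - b * c * z * y \<noteq> 0"
      "qp (b * c * z) p (Suc M) \<noteq> 0"
      using Suc.prems unfolding E_def s s2 by auto
    have IH: "(1 - c * z) * (1 - b * z) * (\<Sum>i\<le>M. vwp a b c e p i) -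
     (1 - b * c * z) * (1 - z) * (\<Sum>i\<le>M. vwp a b c d p i) = G M"
      by (rule Suc.IH) (use nz in auto)
    define g where "g = G M"
    have v: "vwp a b c e p (Suc M) = g * ((1 - a * y ^ 2) * (1 - e) * y) / (E * (1 - b * c * z * y))"
      unfolding ve y2 s g_def G_def E_def power_mult_distrib y_def [symmetric]
      by (simp only: mult_ac times_divide_eq_left times_divide_eq_right divide_divide_eq_left)
    have u: "vwp a b c d p (Suc M) = g * ((1 - a * y ^ 2) * (1 - e * y)) / (E * (1 - b * c * z))"
      unfolding vd y2 s g_def G_def E_def using nz
      by (simp only: mult_ac times_divide_eq_left times_divide_eq_right divide_divide_eq_left)
    have G: "G (Suc M) = g * ((1 - a * y) * (1 - b * y) * (1 - c * y) * (1 - e * y) * z) / (E * (1 - b * c * z * y))"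
      unfolding G_def g_def qp_Suc [of a _ "Suc M"] qp_Suc [of b _ "Suc M"] qp_Suc [of c _ "Suc M"] s E_def y_def [symmetric]
      by (simp only: mult_ac times_divide_eq_left times_divide_eq_right divide_divide_eq_left power_Suc)
    \<comment> \<open>Once the common factor \<open>G M\<close> and the denominators are cleared,
      this is all that is left of the telescoping step.\<close>
    have key: "(1 - c * z) * (1 - b * z) * ((1 - a * y ^ 2) * (1 - e) * y)
       - (1 - z) * ((1 - a * y ^ 2) * (1 - e * y)) * (1 - b * c * z * y) + E * (1 - b * c * z * y)
       = (1 - a * y) * (1 - b * y) * (1 - c * y) * (1 - e * y) * z"
      unfolding E_def a by algebra
    have "(1 - c * z) * (1 - b * z) * vwp a b c e p (Suc M) - (1 - b * c * z) * (1 - z) * vwp a b c d p (Suc M) + g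
       = g * ((1 - c * z) * (1 - b * z) * ((1 - a * y ^ 2) * (1 - e) * y)
       - (1 - z) * ((1 - a * y ^ 2) * (1 - e * y)) * (1 - b * c * z * y) + E * (1 - b * c * z * y)) / (E * (1 - b * c * z * y))"
      unfolding u v using nz by (simp add: divide_simps) algebra
    also have "\<dots> = G (Suc M)"
      unfolding key G ..
    finally show ?case
      unfolding sum.atMost_Suc g_def IH [symmetric] by (simp add: algebra_simps)
  qed
  then show ?thesis
    unfolding e' G_def .
qed

lemma sum_atMost_eq_first:
  assumes "\<And>i. i > 0 \<Longrightarrow> f i = 0"
  shows "(\<Sum>i\<le>M. f i) = f (0::nat)"
  using assms by (induction M) auto

text \<open>Induction on N: the contiguous relation passes from d = p^(-N) to d/p. The bound M stays
  fixed, so that both sums in the relation have the same range; summands beyond N vanish. The factor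
  1 - a is the normalisation omitted from \<open>vwp\<close>.\<close>

lemma vwp_sum:
  fixes a b c p :: "'a::field"
  assumes nz: "b \<noteq> 0" "c \<noteq> 0" "p \<noteq> 0"
    and M: "qp p p M \<noteq> 0"
    and b: "\<And>j. a * p / b * p ^ j \<noteq> 1" and c: "\<And>j. a * p / c * p ^ j \<noteq> 1"
    and a: "\<And>j. a * p ^ Suc j \<noteq> 1"
    and "N \<le> M"
  shows "(\<Sum>i\<le>M. vwp a b c (1 / p ^ N) p i) =
    (1 - a) * qp (a * p) p N * qp (a * p / (b * c)) p N / (qp (a * p / b) p N * qp (a * p / c) p N)"
  using \<open>N \<le> M\<close>
proof (induction N)
  case 0
  have "vwp a b c 1 p i = 0" if "i > 0" for i
    using that by (simp add: vwp_def qp_eq_0_iff) (metis power_0)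
  then have "(\<Sum>i\<le>M. vwp a b c 1 p i) = vwp a b c 1 p 0"
    by (rule sum_atMost_eq_first)
  then show ?case
    by (simp add: vwp_def)
next
  case (Suc N)
  define d where "d = 1 / p ^ N"
  have d: "d \<noteq> 0" "d / p = 1 / p ^ Suc N"
    using nz by (simp_all add: d_def)
  have dx: "x / d = x * p ^ N" "x / (y * d) = x / y * p ^ N" for x y
    by (simp_all add: d_def)
  have nb: "qp (a * p / b) p k \<noteq> 0" and nc: "qp (a * p / c) p k \<noteq> 0" for k
    using b c by (auto simp: qp_eq_0_iff)
  have nd: "qp (a * p / d) p k \<noteq> 0" for k
    unfolding qp_eq_0_iff
  proof safe
    fix j assume "a * p / d * p ^ j = 1"
    then have "a * p ^ Suc (N + j) = 1"
      by (simp add: dx power_add mult_ac)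
    with a show False by blast
  qed
  \<comment> \<open>As N < M, the factor with exponent N kills the boundary term of the telescoping
    relation and leaves a two-term recurrence.\<close>
  have "qp d p M = 0"
    unfolding qp_eq_0_iff using Suc.prems nz by (intro exI[of _ N]) (simp add: d_def)
  then have step: "(1 - a * p / b * p ^ N) * (1 - a * p / c * p ^ N) * (\<Sum>i\<le>M. vwp a b c (1 / p ^ Suc N) p i) =
      (1 - a * p * p ^ N) * (1 - a * p / (b * c) * p ^ N) * (\<Sum>i\<le>M. vwp a b c d p i)"
    using vwp_telescope[OF nz(1,2) d(1) nz(3) M nb nc nd] unfolding dx d(2) by simp
  have IH: "(\<Sum>i\<le>M. vwp a b c d p i) =
    (1 - a) * qp (a * p) p N * qp (a * p / (b * c)) p N / (qp (a * p / b) p N * qp (a * p / c) p N)"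
    unfolding d_def by (rule Suc.IH) (use Suc.prems in simp)
  have n: "1 - a * p / b * p ^ N \<noteq> 0" "1 - a * p / c * p ^ N \<noteq> 0"
    using b[of N] c[of N] by auto
  have aux: "x = r * (u * v) / (s * t)" if "s * t * x = u * v * r" "s \<noteq> 0" "t \<noteq> 0" for s t u v x r :: 'a
    using that by (simp add: divide_simps mult_ac)
  show ?case
    unfolding aux[OF step n] IH qp_Suc by (simp add: mult_ac)
qed

lemma qp_inverse_power_eq_0:
  assumes "q \<noteq> 0" "n < k"
  shows "qp (1 / q ^ n) q k = 0"
  unfolding qp_eq_0_iff using assms by (intro exI[of _ n]) simp

section \<open>The cubic specialisation of the very-well-poised sum\<close>

text \<open>Read from right to left, this expands (a;q^3)_k / (a;q)_(2k), where the two bases meet,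
  into terms that can be summed over k in base q.\<close>

lemma vwp_cubic_sum:
  fixes a q :: "'a::field"
  assumes q: "q \<noteq> 0" and M: "qp (q ^ 3) (q ^ 3) M \<noteq> 0"
    and a: "\<And>j. a * q ^ j \<noteq> 1" and "k \<le> 3 * M + 2"
  shows "(\<Sum>r\<le>M. vwp a (1 / q ^ k) (q / q ^ k) (q ^ 2 / q ^ k) (q ^ 3) r) =
    (1 - a) * qp a (q ^ 3) k * qp (a * q) q k / qp a q (2 * k)"
  using \<open>k \<le> 3 * M + 2\<close>
proof (induction k)
  case 0
  have "vwp a 1 q (q ^ 2) (q ^ 3) i = 0" if "i > 0" for i
    using that by (simp add: vwp_def qp_eq_0_iff) (metis power_0)
  then have "(\<Sum>i\<le>M. vwp a 1 q (q ^ 2) (q ^ 3) i) = vwp a 1 q (q ^ 2) (q ^ 3) 0"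
    by (rule sum_atMost_eq_first)
  then show ?case
    by (simp add: vwp_def)
next
  case (Suc k)
  define p where "p = q ^ 3"
  define b c d where "b = 1 / q ^ k" and "c = q / q ^ k" and "d = q ^ 2 / q ^ k"
  have nz: "b \<noteq> 0" "c \<noteq> 0" "d \<noteq> 0" "p \<noteq> 0"
    using q by (simp_all add: b_def c_def d_def p_def)
  have dp: "d / p = 1 / q ^ Suc k" and b: "b = q / q ^ Suc k" and c: "c = q ^ 2 / q ^ Suc k"
    using q by (simp_all add: b_def c_def d_def p_def divide_simps power2_eq_square power3_eq_cube)
  have e: "a * p / b = a * q ^ (k + 3)" "a * p / c = a * q ^ (k + 2)" "a * p / d = a * q ^ (k + 1)"
    "a * p / (b * d) = a * q ^ (2 * k + 1)" "a * p / (c * d) = a * q ^ (2 * k)"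
    "a * p / (b * c * d) = a * p ^ k"
    using q by (simp_all add: b_def c_def d_def p_def power_add power_mult power2_eq_square
        power3_eq_cube power_mult_distrib mult_ac)
  have n: "qp (a * q ^ m) p i \<noteq> 0" for m i
    unfolding qp_eq_0_iff
  proof safe
    fix j assume "a * q ^ m * p ^ j = 1"
    then have "a * q ^ (m + 3 * j) = 1"
      by (simp only: p_def power_add power_mult mult.assoc)
    with a show False by blast
  qed
  \<comment> \<open>d/p is the new q^(-(k+1)), while b and c already are the other two members of
    the new triple; only the order changes.\<close>
  have rot: "vwp a b c (d / p) p r = vwp a (1 / q ^ Suc k) (q / q ^ Suc k) (q ^ 2 / q ^ Suc k) p r" for r
    unfolding dp b [symmetric] c [symmetric] by (simp only: vwp_rotate [of a "1 / q ^ Suc k"])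
  \<comment> \<open>Depending on k modulo 3, one of b, c, d is p^(-N) with N = k div 3. The
    factorial of d has only M factors, so k = 3N + 2 requires N < M, which the bound 3M + 2 on k + 1
    ensures.\<close>
  have zero: "x * qp b p (Suc M) * qp c p (Suc M) * qp d p M / y * z = 0" for x y z
  proof -
    have "qp b p (Suc M) * qp c p (Suc M) * qp d p M = 0"
    proof -
      define N where "N = k div 3"
      consider "k = 3 * N" | "k = 3 * N + 1" | "k = 3 * N + 2"
        unfolding N_def by linarith
      then show ?thesis
      proof cases
        case 1
        then have "b = 1 / p ^ N" "N < Suc M"
          using Suc.prems by (simp_all add: b_def p_def power_mult)
        then show ?thesis
          using nz by (simp add: qp_inverse_power_eq_0)
      next
        case 2
        then have "c = 1 / p ^ N" "N < Suc M"
          using Suc.prems q by (simp_all add: c_def p_def power_mult)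
        then show ?thesis
          using nz by (simp add: qp_inverse_power_eq_0)
      next
        case 3
        then have "d = 1 / p ^ N" "N < M"
          using Suc.prems q by (simp_all add: d_def p_def power_mult power2_eq_square)
        then show ?thesis
          using nz by (simp add: qp_inverse_power_eq_0)
      qed
    qed
    then show ?thesis by auto
  qed
  have step: "(1 - a * q ^ (2 * k + 1)) * (1 - a * q ^ (2 * k)) *
      (\<Sum>r\<le>M. vwp a (1 / q ^ Suc k) (q / q ^ Suc k) (q ^ 2 / q ^ Suc k) p r) =
      (1 - a * q ^ (k + 1)) * (1 - a * p ^ k) * (\<Sum>r\<le>M. vwp a b c d p r)"
    using vwp_telescope[OF nz M [folded p_def], of a, unfolded e rot zero, OF n n n] by (simp only: right_minus_eq)
  have IH: "(\<Sum>r\<le>M. vwp a b c d p r) = (1 - a) * qp a p k * qp (a * q) q k / qp a q (2 * k)"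
    unfolding b_def c_def d_def p_def by (rule Suc.IH) (use Suc.prems in simp)
  have n: "1 - a * q ^ (2 * k + 1) \<noteq> 0" "1 - a * q ^ (2 * k) \<noteq> 0"
    using a[of "2 * k + 1"] a[of "2 * k"] by (simp_all del: power_Suc)
  have aux: "x = r * (u * v) / (s * t)" if "s * t * x = u * v * r" "s \<noteq> 0" "t \<noteq> 0" for s t u v x r :: 'a
    using that by (simp add: divide_simps mult_ac)
  have k2: "2 * Suc k = Suc (Suc (2 * k))" "a * q * q ^ k = a * q ^ (k + 1)"
    by simp_all
  show ?case
    unfolding p_def [symmetric] aux[OF step n] IH k2 qp_Suc by (simp add: mult_ac)
qed

section \<open>The inner sum and the case l = 0\<close>

text \<open>This is (q^(-k);q)_r = (q;q)_k / (q;q)_(k-r) up to sign and a power of q, written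
  without division.\<close>

lemma qp_inverse_power_mult:
  fixes q :: "'a::field"
  assumes q: "q \<noteq> 0" and "r \<le> k"
  shows "qp (1 / q ^ k) q r * q ^ (k * r) * qp q q (k - r) = (\<Prod>j<r. - (q ^ j)) * qp q q k"
  using \<open>r \<le> k\<close>
proof (induction r)
  case (Suc r)
  define m where "m = k - Suc r"
  have k: "k = m + Suc r" "k - r = Suc m" "k - Suc r = m"
    using Suc.prems by (simp_all add: m_def)
  have "qp (1 / q ^ k) q (Suc r) * q ^ (k * Suc r) * qp q q m =
    qp (1 / q ^ k) q r * q ^ (k * r) * qp q q m * ((1 - 1 / q ^ k * q ^ r) * q ^ k)"
    by (simp add: qp_Suc power_add mult_ac)
  also have "(1 - 1 / q ^ k * q ^ r) * q ^ k = - (q ^ r) * (1 - q * q ^ m)"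
    using q by (simp add: k(1) field_simps power_add)
  finally show ?case
    using Suc by (simp add: k(2,3) qp_Suc mult_ac)
qed simp

text \<open>Serves the surviving term R = n of \<open>bailey_inner_sum\<close>, where the sign and
  the powers of q cancel.\<close>

lemma qp_inverse_power_self:
  fixes q :: "'a::field"
  assumes q: "q \<noteq> 0"
  shows "qp (1 / q ^ n) q n * (\<Prod>j<n. - (q ^ j)) * q ^ n = qp q q n"
proof -
  have 1: "qp (1 / q ^ n) q n = (\<Prod>j<n. 1 - 1 / q ^ Suc j)"
    by (rule qp_divide_power[OF q])
  have 2: "q ^ n = (\<Prod>j<n. q)"
    by simp
  show ?thesis
    unfolding 1 unfolding 2 unfolding qp_def prod.distrib [symmetric]
    by (rule prod.cong) (use q in \<open>simp_all add: field_simps\<close>)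
qed

text \<open>A q-Chu-Vandermonde sum whose value is proportional to (q^(1-m);q)_m, which contains the
  factor 1 - q^0. Here even the partial sums have a closed form, so induction on the upper limit
  suffices.\<close>

lemma vandermonde_vanish:
  fixes b q :: "'a::field"
  assumes q: "q \<noteq> 0" and nz: "qp q q m \<noteq> 0" "qp (b * q) q m \<noteq> 0" and "m > 0"
  shows "(\<Sum>j\<le>m. qp (1 / q ^ m) q j * qp (b * q ^ m) q j * q ^ j / (qp q q j * qp (b * q) q j)) = 0"
proof -
  have partial: "(\<Sum>j\<le>J. qp (1 / q ^ m) q j * qp (b * q ^ m) q j * q ^ j / (qp q q j * qp (b * q) q j)) =
     qp (q / q ^ m) q J * qp (b * q ^ m * q) q J / (qp q q J * qp (b * q) q J)" if "J \<le> m" for J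
    using that
  proof (induction J)
    case (Suc J)
    define y where "y = q ^ m"
    define x where "x = q * q ^ J"
    have y: "y \<noteq> 0" using q by (simp add: y_def)
    have s: "qp (1 / y) q (Suc J) = (1 - 1 / y) * qp (q / y) q J"
      "qp (b * y) q (Suc J) = (1 - b * y) * qp (b * y * q) q J"
      by (simp_all add: qp_Suc_left)
    have s2: "qp q q (Suc J) = qp q q J * (1 - x)" "qp (b * q) q (Suc J) = qp (b * q) q J * (1 - b * x)"
      "qp (q / y) q (Suc J) = qp (q / y) q J * (1 - x / y)"
      "qp (b * y * q) q (Suc J) = qp (b * y * q) q J * (1 - b * y * x)"
      by (simp_all add: qp_Suc x_def mult_ac)
    have "qp q q (Suc J) \<noteq> 0" "qp (b * q) q (Suc J) \<noteq> 0"
      using nz qp_add[of q q "Suc J" "m - Suc J"] qp_add[of "b * q" q "Suc J" "m - Suc J"] Suc.prems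
      by auto
    then have n: "qp q q J \<noteq> 0" "1 - x \<noteq> 0" "qp (b * q) q J \<noteq> 0" "1 - b * x \<noteq> 0"
      unfolding s2 by simp_all
    define P where "P = qp (q / y) q J * qp (b * y * q) q J / (qp q q J * qp (b * q) q J)"
    have aux: "P + P * (u / v) = P * ((v + u) / v)" if "v \<noteq> 0" for u v
      using that by (simp add: field_simps)
    have key: "(1 - x) * (1 - b * x) + (1 - 1 / y) * (1 - b * y) * x = (1 - x / y) * (1 - b * y * x)"
      using y by (simp add: field_simps)
    have "P + qp (1 / y) q (Suc J) * qp (b * y) q (Suc J) * q ^ Suc J / (qp q q (Suc J) * qp (b * q) q (Suc J))
       = P + P * ((1 - 1 / y) * (1 - b * y) * x / ((1 - x) * (1 - b * x)))"
      unfolding s s2(1,2) P_def x_def power_Suc by (simp add: mult_ac)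
    also have "\<dots> = P * (((1 - x) * (1 - b * x) + (1 - 1 / y) * (1 - b * y) * x) / ((1 - x) * (1 - b * x)))"
      using aux n by simp
    also have "\<dots> = qp (q / y) q (Suc J) * qp (b * y * q) q (Suc J) / (qp q q (Suc J) * qp (b * q) q (Suc J))"
      unfolding key s2 P_def by (simp add: mult_ac)
    finally show ?case
      using Suc unfolding y_def [symmetric] P_def by simp
  qed simp
  obtain i where "m = Suc i"
    using \<open>m > 0\<close> gr0_implies_Suc by blast
  then have "qp (q / q ^ m) q m = 0"
    using q qp_inverse_power_eq_0[of q i m] by simp
  then show ?thesis
    using partial[of m] by simp
qed

text \<open>Put k = R + j. The factorials of length R leave the sum, and what remains over j is
  \<open>vandermonde_vanish\<close> with a q^(2R) for b and m = n - R. Only m = 0 survives.\<close>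

lemma bailey_inner_sum:
  fixes a q :: "'a::field"
  assumes q: "q \<noteq> 0" and n: "qp q q n \<noteq> 0" and a: "\<And>j. a * q ^ j \<noteq> 1" and "R \<le> n"
  shows "(\<Sum>k\<le>n. qp (1 / q ^ n) q k * qp (q ^ n * a) q k * q ^ k / (qp q q k * qp (a * q) q k) *
       (q ^ (k * R) * qp (1 / q ^ k) q R / qp (a * q * q ^ k) q R)) =
     (if R = n then qp q q n * qp (q ^ n * a) q n / qp (a * q) q (2 * n) else 0)"
proof -
  define \<sigma> where "\<sigma> = (\<Prod>j<R. - (q ^ j))"
  have nq: "qp q q k \<noteq> 0" if "k \<le> n" for k
    using n qp_add[of q q k "n - k"] that by auto
  have na: "qp (a * q ^ i) q k \<noteq> 0" for i k
    unfolding qp_eq_0_iff using a by (auto simp: mult.assoc power_add [symmetric])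
  define m where "m = n - R"
  have nm: "n = R + m" using \<open>R \<le> n\<close> by (simp add: m_def)
  define f where "f k = qp (1 / q ^ n) q k * qp (q ^ n * a) q k * q ^ k / (qp q q k * qp (a * q) q k) *
       (q ^ (k * R) * qp (1 / q ^ k) q R / qp (a * q * q ^ k) q R)" for k
  have "(\<Sum>k\<le>n. f k) = (\<Sum>k=R..n. f k)"
  proof (rule sum.mono_neutral_right)
    show "\<forall>k\<in>{..n} - {R..n}. f k = 0"
      using q by (auto simp: f_def qp_inverse_power_eq_0)
  qed auto
  also have "\<dots> = (\<Sum>j\<le>m. f (R + j))"
    using sum.shift_bounds_cl_nat_ivl[of f 0 R m] by (simp add: nm add.commute atMost_atLeast0)
  also have "\<dots> = (\<Sum>j\<le>m. \<sigma> * qp (1 / q ^ n) q R * qp (q ^ n * a) q R * q ^ R / qp (a * q) q (2 * R) *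
     (qp (1 / q ^ m) q j * qp (a * q ^ (2 * R) * q ^ m) q j * q ^ j / (qp q q j * qp (a * q ^ (2 * R) * q) q j)))"
  proof (rule sum.cong)
    fix j assume j: "j \<in> {..m}"
    define k where "k = R + j"
    have "qp (1 / q ^ k) q R * q ^ (k * R) * qp q q j = \<sigma> * qp q q k"
      unfolding \<sigma>_def using qp_inverse_power_mult[OF q, of R k] by (simp add: k_def)
    moreover have "qp q q j \<noteq> 0" "qp q q k \<noteq> 0"
      using j by (auto intro!: nq simp: nm k_def)
    ultimately have e1: "q ^ (k * R) * qp (1 / q ^ k) q R = \<sigma> * qp q q k / qp q q j"
      by (simp add: field_simps)
    have e2: "qp (a * q) q k * qp (a * q * q ^ k) q R = qp (a * q) q (2 * R) * qp (a * q ^ (2 * R) * q) q j"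
    proof -
      have "k + R = 2 * R + j"
        by (simp add: k_def)
      then show ?thesis
        using qp_add[of "a * q" q k R] qp_add[of "a * q" q "2 * R" j]
        by (simp only: mult_ac)
    qed
    have e3: "qp (1 / q ^ n) q k = qp (1 / q ^ n) q R * qp (1 / q ^ m) q j"
      unfolding k_def qp_add using q by (simp add: nm power_add)
    have e4: "qp (q ^ n * a) q k = qp (q ^ n * a) q R * qp (a * q ^ (2 * R) * q ^ m) q j"
      unfolding k_def qp_add nm mult_2 by (simp add: power_add mult_ac)
    have "f k = qp (1 / q ^ n) q k * qp (q ^ n * a) q k * q ^ k * (\<sigma> * qp q q k / qp q q j)
       / (qp q q k * (qp (a * q) q k * qp (a * q * q ^ k) q R))"
      unfolding f_def e1 by simp
    also have "\<dots> = \<sigma> * qp (1 / q ^ n) q R * qp (q ^ n * a) q R * q ^ R / qp (a * q) q (2 * R) *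
     (qp (1 / q ^ m) q j * qp (a * q ^ (2 * R) * q ^ m) q j * q ^ j / (qp q q j * qp (a * q ^ (2 * R) * q) q j))"
      unfolding e2 e3 e4 using \<open>qp q q k \<noteq> 0\<close> by (simp add: k_def power_add mult_ac)
    finally show "f (R + j) = \<sigma> * qp (1 / q ^ n) q R * qp (q ^ n * a) q R * q ^ R / qp (a * q) q (2 * R) *
     (qp (1 / q ^ m) q j * qp (a * q ^ (2 * R) * q ^ m) q j * q ^ j / (qp q q j * qp (a * q ^ (2 * R) * q) q j))"
      unfolding k_def .
  qed simp
  also have "\<dots> = (if R = n then qp q q n * qp (q ^ n * a) q n / qp (a * q) q (2 * n) else 0)"
  proof (cases "R = n")
    case True
    have "qp (1 / q ^ n) q n * \<sigma> * q ^ n = qp q q n"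
      unfolding \<sigma>_def True by (rule qp_inverse_power_self[OF q])
    then have "\<sigma> * qp (1 / q ^ n) q n * qp (q ^ n * a) q n * q ^ n = qp q q n * qp (q ^ n * a) q n"
      by (simp add: mult_ac)
    then show ?thesis
      using True by (simp add: m_def)
  next
    case False
    then have "m > 0" using nm by simp
    have "qp (a * q ^ (2 * R) * q) q m \<noteq> 0"
      using na[of "Suc (2 * R)" m] by (simp add: mult_ac)
    from vandermonde_vanish[OF q nq this \<open>m > 0\<close>] False show ?thesis
      unfolding sum_distrib_left [symmetric] by (simp add: m_def)
  qed
  finally show ?thesis
    unfolding f_def .
qed

text \<open>With R = 3r in \<open>bailey_inner_sum\<close> only r = n/3 contributes, and its weight
  \<open>w\<close> gives the right-hand side. The computation carries the factor 1 - a of the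
  unnormalised series and divides it out at the end.\<close>

lemma cubic_sum:
  fixes a q :: "'a::field"
  assumes q: "q \<noteq> 0" and n: "qp q q n \<noteq> 0" and a: "\<And>j. a * q ^ j \<noteq> 1"
  shows "(\<Sum>k\<le>n. qp a (q ^ 3) k * (qp (1 / q ^ n) q k * qp (q ^ n * a) q k) / (qp q q k * qp a q (2 * k)) * q ^ k)
    = (if 3 dvd n then a ^ (n div 3) * (qp q (q ^ 3) (n div 3) * qp (q ^ 2) (q ^ 3) (n div 3)) /
        (qp (q * a) (q ^ 3) (n div 3) * qp (q ^ 2 * a) (q ^ 3) (n div 3)) else 0)"
    (is "?S = ?rhs")
proof -
  define M where "M = n div 3"
  define w where "w r = qp a (q ^ 3) r * (1 - a * (q ^ 3) ^ (2 * r)) * a ^ r / qp (q ^ 3) (q ^ 3) r" for r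
  have na: "qp (a * q ^ i) q k \<noteq> 0" for i k
    unfolding qp_eq_0_iff using a by (auto simp: mult.assoc power_add [symmetric])
  have a1: "1 - a \<noteq> 0"
    using a[of 0] by simp
  have n3: "qp q q (3 * M) \<noteq> 0"
    using n qp_add[of q q "3 * M" "n - 3 * M"] by (auto simp: M_def)
  then have nM: "qp (q ^ 3) (q ^ 3) M \<noteq> 0"
    unfolding qp_triple by (simp add: power3_eq_cube power2_eq_square mult_ac)
  have pair: "(1 - a) * qp a (q ^ 3) k * qp (a * q) q k / qp a q (2 * k) =
      (\<Sum>r\<le>M. w r * (q ^ (k * (3 * r)) * qp (1 / q ^ k) q (3 * r) / qp (a * q * q ^ k) q (3 * r)))"
    if "k \<le> n" for k
  proof -
    have "vwp a (1 / q ^ k) (q / q ^ k) (q ^ 2 / q ^ k) (q ^ 3) r =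
        w r * (q ^ (k * (3 * r)) * qp (1 / q ^ k) q (3 * r) / qp (a * q * q ^ k) q (3 * r))" for r
    proof -
      have e: "a * q ^ 3 / (1 / q ^ k) = a * q * q ^ k * q ^ 2" "a * q ^ 3 / (q / q ^ k) = a * q * q ^ k * q"
        "a * q ^ 3 / (q ^ 2 / q ^ k) = a * q * q ^ k"
        "a * q ^ 3 / (1 / q ^ k * (q / q ^ k) * (q ^ 2 / q ^ k)) = a * q ^ (k * 3)"
        using q by (simp_all add: power3_eq_cube power2_eq_square mult_ac power_mult)
      have p: "q ^ (k * (3 * r)) = (q ^ (k * 3)) ^ r"
        by (simp add: power_mult)
      show ?thesis
        unfolding vwp_def e qp_triple w_def p power_mult_distrib by (simp add: mult_ac)
    qed
    then show ?thesis
      using vwp_cubic_sum[OF q nM a, of k] that by (simp add: M_def)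
  qed
  have "(1 - a) * ?S = (\<Sum>k\<le>n. qp (1 / q ^ n) q k * qp (q ^ n * a) q k * q ^ k / (qp q q k * qp (a * q) q k) *
      ((1 - a) * qp a (q ^ 3) k * qp (a * q) q k / qp a q (2 * k)))"
    unfolding sum_distrib_left
  proof (rule sum.cong)
    fix k
    have "qp (a * q) q k \<noteq> 0"
      using na[of 1 k] by simp
    then show "(1 - a) * (qp a (q ^ 3) k * (qp (1 / q ^ n) q k * qp (q ^ n * a) q k) / (qp q q k * qp a q (2 * k)) * q ^ k) =
      qp (1 / q ^ n) q k * qp (q ^ n * a) q k * q ^ k / (qp q q k * qp (a * q) q k) *
      ((1 - a) * qp a (q ^ 3) k * qp (a * q) q k / qp a q (2 * k))"
      by (simp add: mult_ac)
  qed simp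
  also have "\<dots> = (\<Sum>k\<le>n. \<Sum>r\<le>M. w r * (qp (1 / q ^ n) q k * qp (q ^ n * a) q k * q ^ k / (qp q q k * qp (a * q) q k) *
       (q ^ (k * (3 * r)) * qp (1 / q ^ k) q (3 * r) / qp (a * q * q ^ k) q (3 * r))))"
  proof (rule sum.cong)
    fix k assume "k \<in> {..n}"
    then have "k \<le> n"
      by simp
    show "qp (1 / q ^ n) q k * qp (q ^ n * a) q k * q ^ k / (qp q q k * qp (a * q) q k) *
      ((1 - a) * qp a (q ^ 3) k * qp (a * q) q k / qp a q (2 * k)) =
      (\<Sum>r\<le>M. w r * (qp (1 / q ^ n) q k * qp (q ^ n * a) q k * q ^ k / (qp q q k * qp (a * q) q k) *
       (q ^ (k * (3 * r)) * qp (1 / q ^ k) q (3 * r) / qp (a * q * q ^ k) q (3 * r))))"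
      unfolding pair[OF \<open>k \<le> n\<close>] sum_distrib_left
      by (rule sum.cong) (simp_all only: mult.left_commute)
  qed simp
  also have "\<dots> = (\<Sum>r\<le>M. w r * (if 3 * r = n then qp q q n * qp (q ^ n * a) q n / qp (a * q) q (2 * n) else 0))"
    unfolding sum.swap [of _ "{..M}"] sum_distrib_left [symmetric]
    by (rule sum.cong) (use bailey_inner_sum[OF q n a] in \<open>auto simp: M_def\<close>)
  also have "\<dots> = (\<Sum>r\<le>M. if r = M then (if 3 * M = n then w M * (qp q q n * qp (q ^ n * a) q n / qp (a * q) q (2 * n)) else 0) else 0)"
    by (rule sum.cong) (auto simp: M_def)
  also have "\<dots> = (if 3 * M = n then w M * (qp q q n * qp (q ^ n * a) q n / qp (a * q) q (2 * n)) else 0)"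
    by simp
  also have "\<dots> = (1 - a) * ?rhs"
  proof (cases "3 dvd n")
    case True
    then have nM3: "n = 3 * M" by (simp add: M_def)
    \<comment> \<open>Both sides are (a;q)_(2n+1), split after the first factor on the left, and
      after n and 2n factors on the right.\<close>
    have s1: "(1 - a) * qp (a * q) q (2 * n) = qp a q n * qp (q ^ n * a) q n * (1 - a * (q ^ 3) ^ (2 * M))"
    proof -
      have "(q ^ 3) ^ (2 * M) = q ^ (n + n)"
        unfolding nM3 by (simp add: power_mult [symmetric])
      then show ?thesis
        using qp_Suc_left[of a q "n + n"] unfolding qp_Suc qp_add[of a q n n] mult_2 [of n]
        by (simp add: mult_ac)
    qed
    have s2: "qp a q n = qp a (q ^ 3) M * qp (q * a) (q ^ 3) M * qp (q ^ 2 * a) (q ^ 3) M"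
      unfolding nM3 qp_triple by (simp add: mult_ac)
    have s3: "qp q q n = qp q (q ^ 3) M * qp (q ^ 2) (q ^ 3) M * qp (q ^ 3) (q ^ 3) M"
      unfolding nM3 qp_triple by (simp add: power3_eq_cube power2_eq_square mult_ac)
    have nz: "qp (q ^ n * a) q n \<noteq> 0" "1 - a * (q ^ 3) ^ (2 * M) \<noteq> 0" "qp a q n \<noteq> 0"
      using na[of n n] na[of 0 n] a[of "3 * (2 * M)"] unfolding power_mult [of q 3] by (simp_all add: mult_ac)
    have nz': "qp a (q ^ 3) M \<noteq> 0"
      using nz(3) unfolding s2 by auto
    have "w M * (qp q q n * qp (q ^ n * a) q n / qp (a * q) q (2 * n)) =
      (1 - a) * (w M * (qp q q n * qp (q ^ n * a) q n) / ((1 - a) * qp (a * q) q (2 * n)))"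
      using a1 by simp
    also have "w M * (qp q q n * qp (q ^ n * a) q n) / ((1 - a) * qp (a * q) q (2 * n)) = ?rhs"
      unfolding s1 s2 s3 w_def using True nz nz' nM by (simp add: M_def [symmetric] mult_ac)
    finally show ?thesis
      using nM3 by simp
  next
    case False
    then show ?thesis
      by auto
  qed
  finally show ?thesis
    using a1 by simp
qed

section \<open>Reduction of general l to l = 0 for generic a\<close>

text \<open>A vanishing factor would make a an integer power of q.\<close>

lemma qp_nonzero:
  fixes q :: "'a::field"
  assumes q: "q \<noteq> 0" and gen: "\<And>j::int. a * q powi j \<noteq> 1"
    and u: "u = a * q powi m \<or> u = q powi m / a"
  shows "qp u q k \<noteq> 0"
  unfolding qp_eq_0_iff
proof safe
  fix j assume j: "u * q ^ j = 1"
  show False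
    using u
  proof
    assume "u = a * q powi m"
    then have "a * q powi (m + int j) = 1"
      using j q by (simp add: power_int_add mult_ac)
    then show False using gen by blast
  next
    assume "u = q powi m / a"
    then have "a = q powi (m + int j)"
      using j q by (simp add: power_int_add field_simps split: if_splits)
    then have "a * q powi (- (m + int j)) = 1"
      using q power_int_add[of q "m + int j" "- (m + int j)"] by simp
    then show False using gen by blast
  qed
qed

text \<open>Meant for parameters containing s and t, where genericity only speaks about the square:
  (u;q)_k divides (u^2;q^2)_k, whose factors are among those of base q.\<close>

lemma qp_nonzero_square:
  fixes q :: "'a::field"
  assumes q: "q \<noteq> 0" and gen: "\<And>j::int. a * q powi j \<noteq> 1"
    and u: "u ^ 2 = a * q powi m \<or> u ^ 2 = q powi m / a"
  shows "qp u q k \<noteq> 0"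
proof -
  have "qp (u ^ 2) (q ^ 2) k \<noteq> 0"
    unfolding qp_eq_0_iff
  proof safe
    fix j assume "u ^ 2 * (q ^ 2) ^ j = 1"
    then have "u ^ 2 * q ^ (2 * j) = 1"
      by (simp add: power_mult)
    then have "qp (u ^ 2) q (Suc (2 * j)) = 0"
      by (auto simp: qp_eq_0_iff)
    then show False
      using qp_nonzero[OF q gen u] by blast
  qed
  moreover have "qp (u ^ 2) (q ^ 2) k = qp u q k * qp (- u) q k"
    unfolding qp_def prod.distrib [symmetric]
    by (rule prod.cong) (simp_all add: power_mult [symmetric] mult.commute[of 2] power_mult algebra_simps power2_eq_square)
  ultimately show ?thesis by auto
qed

text \<open>The cancellation that ends \<open>shifted_factor_expansion\<close>, with letters in
  place of factorials. There the first four equations split one product in two ways, the next two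
  are reflections, and the seventh compares monomials.\<close>

lemma cancel_reflected_products:
  fixes x y x' y' :: "'a::field"
  assumes "S1 * Gk = Xk * T1" "S4 * Hk = Yk * T2" "a1 * U1 = U2 * a3" "a4 * V1 = V2 * a2"
    "S3 * U1 * y = T1 * U2 * x" "S2 * V1 * y' = T2 * V2 * x'" "x * y' = x' * y"
    and nz: "Gk \<noteq> 0" "Hk \<noteq> 0" "U1 \<noteq> 0" "V1 \<noteq> 0" "U2 \<noteq> 0" "V2 \<noteq> 0" "x \<noteq> 0" "y \<noteq> 0" "y' \<noteq> 0"
      "S3 \<noteq> 0" "T2 \<noteq> 0" "a3 \<noteq> 0" "a4 \<noteq> 0" "Yk \<noteq> 0" "A1 \<noteq> 0"
  shows "Kk * Xk / Yk = S1 * S2 / (S3 * S4) * (Kk * Gk / (Hk * A1) * (A1 * a1 * a2 / (a3 * a4)))"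
proof -
  have "T1 = S3 * U1 * y / (U2 * x)" "S2 = T2 * V2 * x' / (V1 * y')" "x' = x * y' / y"
    "a1 = U2 * a3 / U1" "a2 = a4 * V1 / V2" "S4 = Yk * T2 / Hk" "S1 = Xk * T1 / Gk"
    using assms by (simp_all add: field_simps)
  then show ?thesis
    using nz by simp
qed

text \<open>
  This is \<open>vwp_sum\<close> at \<open>A = q\<^bsup>-2n\<^esup> / a\<close>, \<open>b = q\<^bsup>-l\<^esup>\<close>, \<open>c = q\<^bsup>1/2-n\<^esup> / t\<close>, \<open>d = q\<^bsup>-(n-k)\<^esup>\<close>. Since
  \<open>c\<^sup>2 = A q\<close>, the factors with \<open>c\<close> cancel from every summand. Terminating the series at \<open>n - k\<close> rather
  than at \<open>l\<close> keeps \<open>(q;q)\<^sub>i\<close> nonzero even if \<open>q\<close> is a root of unity of order between \<open>n\<close> and \<open>l\<close>.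
\<close>

lemma shifted_factor_expansion:
  fixes q s t :: "'a::field"
  assumes s: "s \<noteq> 0" and t: "t \<noteq> 0" and q: "q = s ^ 2" and a: "a = t ^ 2"
    and gen: "\<And>j::int. a * q powi j \<noteq> 1"
    and n: "qp q q n \<noteq> 0" and "k \<le> n"
  shows "qp (1 / q ^ n) q k * qp (q ^ n / q ^ l * a) q k / qp (s / q ^ l * t) q k =
    qp (q ^ n / q ^ l * a) q l * qp (s * q ^ n / q ^ l * t) q l /
      (qp (q ^ (2 * n) / q ^ l * a) q l * qp (s / q ^ l * t) q l) *
    (\<Sum>i\<le>n. (s ^ (5 + 2 * l) / t) ^ i * ((1 - q ^ (2 * n) / q ^ (2 * i) * a) / (1 - q ^ (2 * n) * a)) *
       (qp (1 / q ^ l) q i * qp (1 / q ^ n) q i * qp (1 / (q ^ (2 * n) * a)) q i /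
         (qp q q i * qp (q * q ^ l / (q ^ (2 * n) * a)) q i * qp (q / (q ^ n * a)) q i)) *
       (qp (q ^ i / q ^ n) q k * qp (q ^ n / q ^ i * a) q k / qp (s * t) q k))"
proof -
  have q0: "q \<noteq> 0" and a0: "a \<noteq> 0"
    using s t q a by auto
  note nz = qp_nonzero[OF q0 gen] and nz2 = qp_nonzero_square[OF q0 gen]
  define N where "N = n - k"
  have nN: "n = N + k"
    using \<open>k \<le> n\<close> by (simp add: N_def)
  define A where "A = 1 / (q ^ (2 * n) * a)"
  define c where "c = s / (q ^ n * t)"
  have c0: "c \<noteq> 0" and A0: "A \<noteq> 0"
    using s t q0 a0 by (simp_all add: c_def A_def)
  have cc: "A * q = c * c"
    by (simp add: A_def c_def q a power2_eq_square power_mult mult_ac)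
  then have Aqc: "A * q / c = c"
    using c0 by simp
  have A1: "1 - A \<noteq> 0"
    using gen[of "2 * int n"] q0 a0 by (auto simp: A_def field_simps power_int_mult power_mult)
  have X: "A * q = q / (q ^ (2 * n) * a)" "c = q / (s * q ^ n * t)"
    "A * q * q ^ N = q / (q ^ (n + k) * a)" "c * q ^ N = q / (s * q ^ k * t)"
    using q0 s t a0 unfolding A_def c_def nN mult_2
    by (simp_all add: power_add field_simps) (simp_all add: q power2_eq_square)
  have summand: "(s ^ (5 + 2 * l) / t) ^ i * ((1 - q ^ (2 * n) / q ^ (2 * i) * a) / (1 - q ^ (2 * n) * a)) *
       (qp (1 / q ^ l) q i * qp (1 / q ^ n) q i * qp (1 / (q ^ (2 * n) * a)) q i /
         (qp q q i * qp (q * q ^ l / (q ^ (2 * n) * a)) q i * qp (q / (q ^ n * a)) q i)) *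
       (qp (q ^ i / q ^ n) q k * qp (q ^ n / q ^ i * a) q k / qp (s * t) q k) =
       qp (1 / q ^ n) q k * qp (q ^ n * a) q k / (qp (s * t) q k * (1 - A)) * vwp A (1 / q ^ l) c (1 / q ^ N) q i"
    (is "?L = _") for i
  proof -
    have ci: "qp c q i \<noteq> 0"
      by (rule nz2[of _ "1 - 2 * int n"])
        (use q0 in \<open>simp add: c_def power_divide power_mult_distrib q a power_int_diff power_int_mult
            power_mult [symmetric] mult.commute[of n]\<close>)
    have h1: "qp (1 / q ^ n) q i * qp (q ^ i / q ^ n) q k = qp (1 / q ^ n) q k * qp (1 / q ^ N) q i"
      using qp_add[of "1 / q ^ n" q i k] qp_add[of "1 / q ^ n" q k i] q0
      by (simp add: add.commute) (simp add: nN power_add)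
    \<comment> \<open>Splitting (q^(n-i) a;q)_(i+k) in two ways moves the shift by i off the
      factorial of length k; \<open>qp_reflect\<close> turns the rest into factorials in 1/a at the
      cost of q^(k i).\<close>
    have h2: "qp (q ^ n / q ^ i * a) q k / qp (q / (q ^ n * a)) q i =
       qp (q ^ n * a) q k / (q ^ (k * i) * qp (q / (q ^ (n + k) * a)) q i)"
    proof -
      have r: "qp (q ^ n * a / q ^ i) q i * qp (q / (q ^ (n + k) * a)) q i * (q ^ (n + k) * a) ^ i =
        qp (q ^ (n + k) * a / q ^ i) q i * qp (q / (q ^ n * a)) q i * (q ^ n * a) ^ i"
        by (rule qp_reflect) (use q0 a0 in auto)
      have r2: "qp (q ^ n * a / q ^ i) q i * qp (q ^ n * a) q k = qp (q ^ n * a / q ^ i) q k * qp (q ^ (n + k) * a / q ^ i) q i"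
        using qp_add[of "q ^ n * a / q ^ i" q i k] qp_add[of "q ^ n * a / q ^ i" q k i] q0
        by (simp add: add.commute power_add mult_ac)
      have z: "qp (q ^ n * a / q ^ i) q i \<noteq> 0" "qp (q / (q ^ (n + k) * a)) q i \<noteq> 0"
         "qp (q / (q ^ n * a)) q i \<noteq> 0" "qp (q ^ (n + k) * a / q ^ i) q i \<noteq> 0"
        using q0 nz[of "q ^ n * a / q ^ i" "int n - int i"] nz[of "q / (q ^ (n + k) * a)" "1 - int (n + k)"]
          nz[of "q / (q ^ n * a)" "1 - int n"] nz[of "q ^ (n + k) * a / q ^ i" "int (n + k) - int i"]
        by (simp_all add: power_int_diff mult.commute del: of_nat_add)
      have e: "qp (q ^ n / q ^ i * a) q k = qp (q ^ n * a / q ^ i) q k"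
        by simp
      have pw: "(q ^ (n + k) * a) ^ i = (q ^ n * a) ^ i * q ^ (k * i)"
        unfolding power_mult [of q k i] by (simp add: power_add power_mult_distrib mult_ac)
      have z5: "(q ^ n * a) ^ i \<noteq> 0"
        using q0 a0 by simp
      have "u / v = w / (p * x)"
        if "f * x * (y * p) = g * v * y" "f * w = u * g" "f \<noteq> 0" "x \<noteq> 0" "v \<noteq> 0" "g \<noteq> 0" "y \<noteq> 0" "p \<noteq> 0"
        for f x y p g v w u :: 'a
      proof -
        have "f * x * p = g * v"
          using that by (simp add: mult_ac)
        then have "f * (u * (p * x)) = f * (w * v)"
          using that(2) by algebra
        then show ?thesis
          using that by (simp add: frac_eq_eq)
      qed
      from this[OF r[unfolded pw] r2 z(1,2,3,4) z5] show ?thesis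
        unfolding e using q0 by simp
    qed
    have h3: "(1 - q ^ (2 * n) / q ^ (2 * i) * a) / (1 - q ^ (2 * n) * a) = (1 - A * q ^ (2 * i)) / (1 - A) / q ^ (2 * i)"
    proof -
      define x y where "x = q ^ (2 * n) * a" and "y = q ^ (2 * i)"
      have "x \<noteq> 0" "y \<noteq> 0" "1 - x \<noteq> 0" "A = 1 / x"
        using q0 a0 A1 by (auto simp: x_def y_def A_def)
      moreover from this have "1 - x / y = (y - x) / y" "1 - A * y = - ((y - x) / x)" "1 - A = - ((1 - x) / x)"
        by (simp_all add: field_simps)
      ultimately have "(1 - x / y) / (1 - x) = (1 - A * y) / (1 - A) / y"
        by (simp add: mult.commute minus_divide_left)
          (metis minus_diff_eq minus_divide_divide mult_minus_right)
      then show ?thesis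
        by (simp add: x_def y_def)
    qed
    \<comment> \<open>q^(-2i) comes from \<open>h3\<close> and q^(-k i) from \<open>h2\<close>. With
      the power of s they form the argument of the series, since s^5 / q^2 = s.\<close>
    have h4: "(s ^ (5 + 2 * l) / t) ^ i / q ^ (2 * i) / q ^ (k * i) = (A * q / (1 / q ^ l * c * (1 / q ^ N))) ^ i"
    proof -
      have "s ^ (5 + 2 * l) / t / q ^ 2 / q ^ k = s * q ^ l / (t * q ^ k)"
        using s by (simp add: q power_add power_mult power_mult_distrib eval_nat_numeral)
      also have "\<dots> = A * q / (1 / q ^ l * c * (1 / q ^ N))"
        using q0 c0 unfolding cc by (simp add: c_def nN power_add)
      finally have "A * q / (1 / q ^ l * c * (1 / q ^ N)) = s ^ (5 + 2 * l) / t / q ^ 2 / q ^ k" ..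
      then show ?thesis
        by (simp only: power_divide power_mult)
    qed
    have h5: "A * q / (1 / q ^ l) = q * q ^ l / (q ^ (2 * n) * a)" "A * q / (1 / q ^ N) = q / (q ^ (n + k) * a)"
      using X(3) by (simp_all add: A_def)
    have "?L = (s ^ (5 + 2 * l) / t) ^ i * ((1 - q ^ (2 * n) / q ^ (2 * i) * a) / (1 - q ^ (2 * n) * a)) *
       (qp (1 / q ^ l) q i * (qp (1 / q ^ n) q i * qp (q ^ i / q ^ n) q k) * qp A q i * (qp (q ^ n / q ^ i * a) q k / qp (q / (q ^ n * a)) q i) /
         (qp q q i * qp (q * q ^ l / (q ^ (2 * n) * a)) q i * qp (s * t) q k))"
      unfolding A_def by (simp add: mult_ac)
    also have "\<dots> = ((s ^ (5 + 2 * l) / t) ^ i / q ^ (2 * i) / q ^ (k * i)) * ((1 - A * q ^ (2 * i)) / (1 - A)) *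
       (qp (1 / q ^ l) q i * (qp (1 / q ^ n) q k * qp (1 / q ^ N) q i) * qp A q i * (qp (q ^ n * a) q k / qp (q / (q ^ (n + k) * a)) q i) /
         (qp q q i * qp (q * q ^ l / (q ^ (2 * n) * a)) q i * qp (s * t) q k))"
      unfolding h1 h2 h3 by (simp add: mult_ac)
    also have "\<dots> = qp (1 / q ^ n) q k * qp (q ^ n * a) q k / (qp (s * t) q k * (1 - A)) * vwp A (1 / q ^ l) c (1 / q ^ N) q i"
      unfolding h4 vwp_def h5 Aqc using ci by (simp add: mult_ac)
    finally show ?thesis .
  qed
  \<comment> \<open>\<open>vwp_sum\<close> is used with M = n, so the range of i does not depend on
    k and the sums can later be exchanged.\<close>
  have W: "(\<Sum>i\<le>n. vwp A (1 / q ^ l) c (1 / q ^ N) q i) = (1 - A) * qp (A * q) q N * qp (c * q ^ l) q N /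
     (qp (A * q * q ^ l) q N * qp c q N)"
  proof -
    have b: "A * q / (1 / q ^ l) * q ^ j \<noteq> 1" and c: "A * q / c * q ^ j \<noteq> 1" and A: "A * q ^ Suc j \<noteq> 1" for j
    proof -
      have "qp (A * q / (1 / q ^ l)) q (Suc j) \<noteq> 0"
        by (rule nz[of _ "1 + int l - 2 * int n"])
          (use q0 in \<open>simp add: A_def power_int_diff power_int_add power_int_mult power_mult\<close>)
      then show "A * q / (1 / q ^ l) * q ^ j \<noteq> 1"
        by (auto simp: qp_eq_0_iff)
      have "qp c q (Suc j) \<noteq> 0"
        by (rule nz2[of _ "1 - 2 * int n"])
          (use q0 in \<open>simp add: c_def power_divide power_mult_distrib q a power_int_diff power_int_mult
            power_mult [symmetric] mult.commute[of n]\<close>)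
      then show "A * q / c * q ^ j \<noteq> 1"
        unfolding Aqc by (auto simp: qp_eq_0_iff)
      have "qp A q (Suc (Suc j)) \<noteq> 0"
        by (rule nz[of _ "- 2 * int n"])
          (use q0 in \<open>simp add: A_def power_int_diff power_int_minus power_int_mult power_mult field_simps\<close>)
      then show "A * q ^ Suc j \<noteq> 1"
        unfolding qp_eq_0_iff by blast
    qed
    have "(1 / q ^ l) \<noteq> 0" "N \<le> n"
      using q0 by (simp_all add: nN)
    from vwp_sum[OF this(1) c0 q0 n b c A this(2)] show ?thesis
      unfolding Aqc using cc c0 by (simp add: mult_ac)
  qed
  have e1: "qp (q ^ n / q ^ l * a) q l * qp (q ^ n * a) q k = qp (q ^ n / q ^ l * a) q k * qp (q ^ (n + k) * a / q ^ l) q l"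
    using qp_add[of "q ^ n / q ^ l * a" q l k] qp_add[of "q ^ n / q ^ l * a" q k l] q0
    by (simp add: add.commute power_add mult_ac)
  have e2: "qp (s / q ^ l * t) q l * qp (s * t) q k = qp (s / q ^ l * t) q k * qp (s * q ^ k * t / q ^ l) q l"
    using qp_add[of "s / q ^ l * t" q l k] qp_add[of "s / q ^ l * t" q k l] q0
    by (simp add: add.commute power_add mult_ac)
  have e3: "qp (A * q) q N * qp (q / (q ^ (n + k) * a)) q l = qp (q / (q ^ (2 * n) * a)) q l * qp (A * q * q ^ l) q N"
    using qp_add[of "A * q" q N l] qp_add[of "A * q" q l N] unfolding X(3) X(1) [symmetric]
    by (simp add: add.commute)
  have e4: "qp c q N * qp (q / (s * q ^ k * t)) q l = qp (q / (s * q ^ n * t)) q l * qp (c * q ^ l) q N"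
    using qp_add[of c q N l] qp_add[of c q l N] unfolding X(4) X(2) [symmetric]
    by (simp add: add.commute)
  have r1: "qp (q ^ (2 * n) * a / q ^ l) q l * qp (q / (q ^ (n + k) * a)) q l * (q ^ (n + k) * a) ^ l =
      qp (q ^ (n + k) * a / q ^ l) q l * qp (q / (q ^ (2 * n) * a)) q l * (q ^ (2 * n) * a) ^ l"
    by (rule qp_reflect) (use q0 a0 in auto)
  have r2: "qp (s * q ^ n * t / q ^ l) q l * qp (q / (s * q ^ k * t)) q l * (s * q ^ k * t) ^ l =
      qp (s * q ^ k * t / q ^ l) q l * qp (q / (s * q ^ n * t)) q l * (s * q ^ n * t) ^ l"
    by (rule qp_reflect) (use q0 s t in auto)
  have "(q ^ (2 * n) * a * (s * q ^ k * t)) ^ l = (s * q ^ n * t * (q ^ (n + k) * a)) ^ l"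
    unfolding mult_2 by (simp add: power_add mult_ac)
  then have r3: "(q ^ (2 * n) * a) ^ l * (s * q ^ k * t) ^ l = (s * q ^ n * t) ^ l * (q ^ (n + k) * a) ^ l"
    by (simp only: power_mult_distrib)
  have pz: "(q ^ (2 * n) * a) ^ l \<noteq> 0" "(s * q ^ k * t) ^ l \<noteq> 0" "(q ^ (n + k) * a) ^ l \<noteq> 0"
    using q0 s t a0 by simp_all
  have r1': "qp (q ^ (2 * n) / q ^ l * a) q l * qp (q / (q ^ (n + k) * a)) q l * (q ^ (n + k) * a) ^ l =
      qp (q ^ (n + k) * a / q ^ l) q l * qp (q / (q ^ (2 * n) * a)) q l * (q ^ (2 * n) * a) ^ l"
    using r1 by simp
  have r2': "qp (s * q ^ n / q ^ l * t) q l * qp (q / (s * q ^ k * t)) q l * (s * q ^ k * t) ^ l =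
      qp (s * q ^ k * t / q ^ l) q l * qp (q / (s * q ^ n * t)) q l * (s * q ^ n * t) ^ l"
    using r2 by simp
  show ?thesis
    unfolding summand sum_distrib_left [symmetric] W
  proof (rule cancel_reflected_products[OF e1 e2 e3 e4 r1' r2' r3 _ _ _ _ _ _ pz(1,3,2) _ _ _ _ _ A1])
    show "qp (q ^ n * a) q k \<noteq> 0"
      by (rule nz[of _ "int n"]) simp
    show "qp (s * t) q k \<noteq> 0"
      by (rule nz2[of _ 1]) (simp add: q a power_mult_distrib)
    show "qp (q / (q ^ (n + k) * a)) q l \<noteq> 0"
      by (rule nz[of _ "1 - int (n + k)"]) (use q0 in \<open>simp add: power_int_diff del: of_nat_add\<close>)
    show "qp (q / (q ^ (2 * n) * a)) q l \<noteq> 0"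
      by (rule nz[of _ "1 - int (2 * n)"]) (use q0 in \<open>simp add: power_int_diff del: of_nat_mult\<close>)
    show "qp (q / (s * q ^ k * t)) q l \<noteq> 0"
      by (rule nz2[of _ "1 - int (2 * k)"]) (use q0 s in \<open>simp add: power_int_diff q a power_divide power_mult_distrib power2_eq_square power_mult del: of_nat_mult\<close>)
    show "qp (q / (s * q ^ n * t)) q l \<noteq> 0"
      by (rule nz2[of _ "1 - int (2 * n)"]) (use q0 s in \<open>simp add: power_int_diff q a power_divide power_mult_distrib power2_eq_square power_mult del: of_nat_mult\<close>)
    show "qp (q ^ (2 * n) / q ^ l * a) q l \<noteq> 0"
      by (rule nz[of _ "int (2 * n) - int l"]) (use q0 in \<open>simp add: power_int_diff del: of_nat_mult\<close>)
    show "qp (s * q ^ k * t / q ^ l) q l \<noteq> 0"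
      by (rule nz2[of _ "1 + 2 * int k - 2 * int l"]) (use q0 s in \<open>simp add: power_int_diff power_int_add power_int_mult q a power_divide power_mult_distrib power_mult [symmetric] mult_ac\<close>)
    show "qp (A * q * q ^ l) q N \<noteq> 0"
      by (rule nz[of _ "1 + int l - int (2 * n)"]) (use q0 in \<open>simp add: A_def power_int_diff power_int_add del: of_nat_mult\<close>)
    show "qp c q N \<noteq> 0"
      by (rule nz2[of _ "1 - int (2 * n)"]) (use q0 s in \<open>simp add: c_def power_int_diff q a power_divide power_mult_distrib power2_eq_square power_mult del: of_nat_mult\<close>)
    show "qp (s / q ^ l * t) q k \<noteq> 0"
      by (rule nz2[of _ "1 - int (2 * l)"]) (use q0 s in \<open>simp add: power_int_diff q a power_divide power_mult_distrib power2_eq_square power_mult del: of_nat_mult\<close>)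
  qed
qed

lemma cubic_transformation_generic:
  fixes q s t :: "'a::field"
  assumes s: "s \<noteq> 0" and t: "t \<noteq> 0" and q: "q = s ^ 2" and a: "a = t ^ 2"
    and gen: "\<And>j::int. a * q powi j \<noteq> 1"
    and n: "qp q q n \<noteq> 0"
  shows "(\<Sum>k\<le>n. qp a (q ^ 3) k * ((qp (1 / q ^ n) q k * qp (q ^ n / q ^ l * a) q k) /
      (qp q q k * qp t q k * qp (- t) q k * qp (s / q ^ l * t) q k * qp (- (s * t)) q k)) * q ^ k) =
    qp (q ^ n / q ^ l * a) q l * qp (s * q ^ n / q ^ l * t) q l /
      (qp (q ^ (2 * n) / q ^ l * a) q l * qp (s / q ^ l * t) q l) *
    (\<Sum>i | i \<le> l \<and> i \<le> n \<and> 3 dvd (n - i).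
       (s ^ (5 + 2 * l) / t) ^ i * ((1 - q ^ (2 * n) / q ^ (2 * i) * a) / (1 - q ^ (2 * n) * a)) *
       (qp (1 / q ^ l) q i * qp (1 / q ^ n) q i * qp (1 / (q ^ (2 * n) * a)) q i /
         (qp q q i * qp (q * q ^ l / (q ^ (2 * n) * a)) q i * qp (q / (q ^ n * a)) q i)) *
       (a ^ ((n - i) div 3) * (qp q (q ^ 3) ((n - i) div 3) * qp (q ^ 2) (q ^ 3) ((n - i) div 3)) /
        (qp (q * a) (q ^ 3) ((n - i) div 3) * qp (q ^ 2 * a) (q ^ 3) ((n - i) div 3))))"
    (is "?L = ?P * ?R")
proof -
  have q0: "q \<noteq> 0"
    using s q by simp
  define c where "c i = (s ^ (5 + 2 * l) / t) ^ i * ((1 - q ^ (2 * n) / q ^ (2 * i) * a) / (1 - q ^ (2 * n) * a)) *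
       (qp (1 / q ^ l) q i * qp (1 / q ^ n) q i * qp (1 / (q ^ (2 * n) * a)) q i /
         (qp q q i * qp (q * q ^ l / (q ^ (2 * n) * a)) q i * qp (q / (q ^ n * a)) q i))" for i
  define S where "S m = a ^ (m div 3) * (qp q (q ^ 3) (m div 3) * qp (q ^ 2) (q ^ 3) (m div 3)) /
        (qp (q * a) (q ^ 3) (m div 3) * qp (q ^ 2 * a) (q ^ 3) (m div 3))" for m
  define B where "B k = qp a (q ^ 3) k * q ^ k / (qp q q k * qp t q k * qp (- t) q k * qp (- (s * t)) q k)" for k
  have gen': "a * q ^ j \<noteq> 1" for j
    using gen[of "int j"] by simp
  \<comment> \<open>For fixed i the sum over k is the case l = 0 at m = n - i:
    \<open>qp_quadruple\<close> supplies (a;q)_(2k), and summands with k > m vanish through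
    (q^(-m);q)_k.\<close>
  have S: "(\<Sum>k\<le>n. B k * (qp (q ^ i / q ^ n) q k * qp (q ^ n / q ^ i * a) q k / qp (s * t) q k)) =
      (if 3 dvd (n - i) then S (n - i) else 0)" if "i \<le> n" for i
  proof -
    define m where "m = n - i"
    have nm: "n = m + i"
      using that by (simp add: m_def)
    have m: "qp q q m \<noteq> 0"
      using n qp_add[of q q m i] by (auto simp: nm)
    have e: "q ^ i / q ^ n = 1 / q ^ m" "q ^ n / q ^ i = q ^ m"
      using q0 by (simp_all add: nm power_add)
    have "(\<Sum>k\<le>n. B k * (qp (q ^ i / q ^ n) q k * qp (q ^ n / q ^ i * a) q k / qp (s * t) q k)) =
      (\<Sum>k\<le>n. qp a (q ^ 3) k * (qp (1 / q ^ m) q k * qp (q ^ m * a) q k) / (qp q q k * qp a q (2 * k)) * q ^ k)"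
      unfolding e
    proof (rule sum.cong)
      fix k
      have "qp a q (2 * k) = qp t q k * qp (- t) q k * qp (s * t) q k * qp (- (s * t)) q k"
        unfolding a q by (rule qp_quadruple [symmetric])
      then show "B k * (qp (1 / q ^ m) q k * qp (q ^ m * a) q k / qp (s * t) q k) =
        qp a (q ^ 3) k * (qp (1 / q ^ m) q k * qp (q ^ m * a) q k) / (qp q q k * qp a q (2 * k)) * q ^ k"
        unfolding B_def by (simp add: mult_ac)
    qed simp
    also have "\<dots> = (\<Sum>k\<le>m. qp a (q ^ 3) k * (qp (1 / q ^ m) q k * qp (q ^ m * a) q k) / (qp q q k * qp a q (2 * k)) * q ^ k)"
      by (rule sum.mono_neutral_right) (auto simp: nm qp_inverse_power_eq_0[OF q0])
    also have "\<dots> = (if 3 dvd m then S m else 0)"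
      unfolding S_def by (rule cubic_sum[OF q0 m gen'])
    finally show ?thesis
      unfolding m_def .
  qed
  have "?L = (\<Sum>k\<le>n. B k * (?P * (\<Sum>i\<le>n. c i * (qp (q ^ i / q ^ n) q k * qp (q ^ n / q ^ i * a) q k / qp (s * t) q k))))"
  proof (rule sum.cong)
    fix k assume "k \<in> {..n}"
    then have "k \<le> n"
      by simp
    from shifted_factor_expansion[OF s t q a gen n this, of l, folded c_def]
    show "qp a (q ^ 3) k * ((qp (1 / q ^ n) q k * qp (q ^ n / q ^ l * a) q k) /
      (qp q q k * qp t q k * qp (- t) q k * qp (s / q ^ l * t) q k * qp (- (s * t)) q k)) * q ^ k =
      B k * (?P * (\<Sum>i\<le>n. c i * (qp (q ^ i / q ^ n) q k * qp (q ^ n / q ^ i * a) q k / qp (s * t) q k)))"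
      unfolding B_def by (simp only: flip: \<open>_ = ?P * _\<close>) (simp add: mult_ac)
  qed simp
  also have "\<dots> = ?P * (\<Sum>k\<le>n. \<Sum>i\<le>n. c i * (B k * (qp (q ^ i / q ^ n) q k * qp (q ^ n / q ^ i * a) q k / qp (s * t) q k)))"
    by (simp only: sum_distrib_left mult.left_commute)
  also have "\<dots> = ?P * (\<Sum>i\<le>n. \<Sum>k\<le>n. c i * (B k * (qp (q ^ i / q ^ n) q k * qp (q ^ n / q ^ i * a) q k / qp (s * t) q k)))"
    by (subst sum.swap) (rule refl)
  also have "\<dots> = ?P * (\<Sum>i\<le>n. c i * (if 3 dvd (n - i) then S (n - i) else 0))"
    unfolding sum_distrib_left [symmetric] using S by simp
  \<comment> \<open>The factor (q^(-l);q)_i kills i > l.\<close>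
  also have "(\<Sum>i\<le>n. c i * (if 3 dvd (n - i) then S (n - i) else 0)) =
      (\<Sum>i | i \<le> l \<and> i \<le> n \<and> 3 dvd (n - i). c i * (if 3 dvd (n - i) then S (n - i) else 0))"
    by (rule sum.mono_neutral_right) (use q0 in \<open>auto simp: c_def qp_inverse_power_eq_0\<close>)
  also have "\<dots> = (\<Sum>i | i \<le> l \<and> i \<le> n \<and> 3 dvd (n - i). c i * S (n - i))"
    by (rule sum.cong) auto
  finally show ?thesis
    unfolding c_def S_def .
qed

section \<open>Natural indices of \<open>qpoch\<close>, and the passage from generic to arbitrary t
  by continuity\<close>

lemma qpoch_nat: "qpoch x q (int k) = qp x q k"
proof -
  have "{0..int k - 1} = int ` {..<k}"
    unfolding lessThan_atLeast0 image_int_atLeastLessThan by auto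
  then show ?thesis
    by (simp add: qpoch_def qp_def prod.reindex)
qed

lemma isCont_qp [continuous_intros]:
  fixes f :: "complex \<Rightarrow> complex"
  assumes "isCont f x"
  shows "isCont (\<lambda>t. qp (f t) q k) x"
  unfolding qp_def by (intro continuous_intros assms)

text \<open>Besides 0, each j excludes at most the two square roots of q^(-j).\<close>

lemma countable_nongeneric:
  fixes q :: complex
  shows "countable {t. t = 0 \<or> (\<exists>j::int. t ^ 2 * q powi j = 1)}"
proof -
  have "{t. t = 0 \<or> (\<exists>j::int. t ^ 2 * q powi j = 1)} \<subseteq>
      insert 0 (\<Union>j::int. {csqrt (1 / q powi j), - csqrt (1 / q powi j)})"
  proof safe
    fix t j assume "t ^ 2 * q powi j = 1" "t \<notin> (\<Union>j::int. {csqrt (1 / q powi j), - csqrt (1 / q powi j)})"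
    then have "t ^ 2 = 1 / q powi j"
      by (metis mult_zero_right nonzero_eq_divide_eq zero_neq_one)
    then have "t ^ 2 = csqrt (1 / q powi j) ^ 2"
      by simp
    then show "t = 0"
      using \<open>t \<notin> _\<close> unfolding power2_eq_iff by blast
  qed
  then show ?thesis
    by (rule countable_subset) auto
qed

text \<open>A ball is uncountable and the excluded points are countable. Hence limits along generic
  points are unique, even for |q| = 1, where excluded points may accumulate at
  \<open>t0\<close>.\<close>

lemma generic_points_accumulate:
  fixes q t0 :: complex
  shows "at t0 within {t. t \<noteq> 0 \<and> (\<forall>j::int. t ^ 2 * q powi j \<noteq> 1)} \<noteq> bot"
  unfolding trivial_limit_within islimpt_approachable
proof (simp, safe)
  fix e :: real assume "e > 0"
  then have "uncountable (ball t0 e)"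
    by (rule uncountable_ball)
  moreover have "countable (insert t0 {t. t = 0 \<or> (\<exists>j::int. t ^ 2 * q powi j = 1)})"
    using countable_nongeneric by simp
  ultimately have "\<not> ball t0 e \<subseteq> insert t0 {t. t = 0 \<or> (\<exists>j::int. t ^ 2 * q powi j = 1)}"
    using countable_subset by blast
  then show "\<exists>x'. x' \<noteq> 0 \<and> (\<forall>j::int. x' ^ 2 * q powi j \<noteq> 1) \<and> x' \<noteq> t0 \<and> dist x' t0 < e"
    by (auto simp: dist_commute)
qed

text \<open>Only t varies, with s and q fixed and a = t^2. Both sides are continuous at t by the
  nonvanishing denominators and agree at generic points, so they agree at t.\<close>

lemma cubic_transformation:
  fixes q s t a :: complex
  assumes s: "s \<noteq> 0" and t: "t \<noteq> 0" and q: "q = s ^ 2" and a: "a = t ^ 2"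
    and lhs: "\<And>k. k \<le> n \<Longrightarrow> qp q q k \<noteq> 0 \<and> qp t q k \<noteq> 0 \<and> qp (- t) q k \<noteq> 0 \<and>
      qp (s / q ^ l * t) q k \<noteq> 0 \<and> qp (- (s * t)) q k \<noteq> 0"
    and pre: "qp (q ^ (2 * n) / q ^ l * a) q l \<noteq> 0" "qp (s / q ^ l * t) q l \<noteq> 0"
    and rhs: "\<And>i. i \<le> l \<Longrightarrow> i \<le> n \<Longrightarrow> 3 dvd (n - i) \<Longrightarrow>
      1 - q ^ (2 * n) * a \<noteq> 0 \<and> qp q q i \<noteq> 0 \<and> qp (q * q ^ l / (q ^ (2 * n) * a)) q i \<noteq> 0 \<and>
      qp (q / (q ^ n * a)) q i \<noteq> 0 \<and> qp (q * a) (q ^ 3) ((n - i) div 3) \<noteq> 0 \<and>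
      qp (q ^ 2 * a) (q ^ 3) ((n - i) div 3) \<noteq> 0"
  shows "(\<Sum>k\<le>n. qp a (q ^ 3) k * ((qp (1 / q ^ n) q k * qp (q ^ n / q ^ l * a) q k) /
      (qp q q k * qp t q k * qp (- t) q k * qp (s / q ^ l * t) q k * qp (- (s * t)) q k)) * q ^ k) =
    qp (q ^ n / q ^ l * a) q l * qp (s * q ^ n / q ^ l * t) q l /
      (qp (q ^ (2 * n) / q ^ l * a) q l * qp (s / q ^ l * t) q l) *
    (\<Sum>i | i \<le> l \<and> i \<le> n \<and> 3 dvd (n - i).
       (s ^ (5 + 2 * l) / t) ^ i * ((1 - q ^ (2 * n) / q ^ (2 * i) * a) / (1 - q ^ (2 * n) * a)) *
       (qp (1 / q ^ l) q i * qp (1 / q ^ n) q i * qp (1 / (q ^ (2 * n) * a)) q i /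
         (qp q q i * qp (q * q ^ l / (q ^ (2 * n) * a)) q i * qp (q / (q ^ n * a)) q i)) *
       (a ^ ((n - i) div 3) * (qp q (q ^ 3) ((n - i) div 3) * qp (q ^ 2) (q ^ 3) ((n - i) div 3)) /
        (qp (q * a) (q ^ 3) ((n - i) div 3) * qp (q ^ 2 * a) (q ^ 3) ((n - i) div 3))))"
proof -
  define L where "L u = (\<Sum>k\<le>n. qp (u ^ 2) (q ^ 3) k * ((qp (1 / q ^ n) q k * qp (q ^ n / q ^ l * u ^ 2) q k) /
      (qp q q k * qp u q k * qp (- u) q k * qp (s / q ^ l * u) q k * qp (- (s * u)) q k)) * q ^ k)" for u
  define R where "R u = qp (q ^ n / q ^ l * u ^ 2) q l * qp (s * q ^ n / q ^ l * u) q l /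
      (qp (q ^ (2 * n) / q ^ l * u ^ 2) q l * qp (s / q ^ l * u) q l) *
    (\<Sum>i | i \<le> l \<and> i \<le> n \<and> 3 dvd (n - i).
       (s ^ (5 + 2 * l) / u) ^ i * ((1 - q ^ (2 * n) / q ^ (2 * i) * u ^ 2) / (1 - q ^ (2 * n) * u ^ 2)) *
       (qp (1 / q ^ l) q i * qp (1 / q ^ n) q i * qp (1 / (q ^ (2 * n) * u ^ 2)) q i /
         (qp q q i * qp (q * q ^ l / (q ^ (2 * n) * u ^ 2)) q i * qp (q / (q ^ n * u ^ 2)) q i)) *
       ((u ^ 2) ^ ((n - i) div 3) * (qp q (q ^ 3) ((n - i) div 3) * qp (q ^ 2) (q ^ 3) ((n - i) div 3)) /
        (qp (q * u ^ 2) (q ^ 3) ((n - i) div 3) * qp (q ^ 2 * u ^ 2) (q ^ 3) ((n - i) div 3))))" for u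
  have q0: "q \<noteq> 0"
    using s q by simp
  define F where "F = at t within {u. u \<noteq> 0 \<and> (\<forall>j::int. u ^ 2 * q powi j \<noteq> 1)}"
  have "isCont L t"
    unfolding L_def
    by (intro continuous_intros) (use lhs in auto)
  then have L: "(L \<longlongrightarrow> L t) F"
    unfolding F_def isCont_def by (rule tendsto_within_subset) simp
  have "isCont R t"
    unfolding R_def
    by (intro continuous_intros) (use pre rhs s t q0 in \<open>auto simp: a\<close>)
  then have R: "(R \<longlongrightarrow> R t) F"
    unfolding F_def isCont_def by (rule tendsto_within_subset) simp
  \<comment> \<open>The generic case also requires (q;q)_n to be nonzero; this is \<open>lhs\<close>
    at k = n and does not involve u.\<close>
  have "L u = R u" if "u \<noteq> 0" "\<forall>j::int. u ^ 2 * q powi j \<noteq> 1" for u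
    unfolding L_def R_def
    by (rule cubic_transformation_generic[OF s that(1) q refl]) (use that lhs in auto)
  then have "eventually (\<lambda>u. L u = R u) F"
    unfolding F_def eventually_at_filter by simp
  then have "(R \<longlongrightarrow> L t) F"
    using L tendsto_cong by blast
  then have "L t = R t"
    using R tendsto_unique generic_points_accumulate unfolding F_def by blast
  then show ?thesis
    unfolding L_def R_def a .
qed

section \<open>The identity with integer indices\<close>

theorem theorem3:
  fixes l n :: nat and a q sqrt_a sqrt_q :: complex
  assumes a_nz: "a \<noteq> 0" and q_nz: "q \<noteq> 0"
    and sqrt_a: "sqrt_a ^ 2 = a" and sqrt_q: "sqrt_q ^ 2 = q"
    and lhs_denominators: "\<And>k::nat. k \<le> n \<Longrightarrow>
          qpoch q q k \<noteq> 0 \<and> qpoch sqrt_a q k \<noteq> 0 \<and> qpoch (- sqrt_a) q k \<noteq> 0 \<and>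
          qpoch (sqrt_q powi (1 - 2 * int l) * sqrt_a) q k \<noteq> 0 \<and>
          qpoch (- (sqrt_q * sqrt_a)) q k \<noteq> 0"
    and prefactor_denominators:
          "qpoch (q powi (2 * int n - int l) * a) q l \<noteq> 0"
          "qpoch (sqrt_q powi (1 - 2 * int l) * sqrt_a) q l \<noteq> 0"
    and rhs_denominators: "\<And>i::nat. i \<le> l \<Longrightarrow> 3 dvd (int n - int i) \<Longrightarrow>
          1 - q ^ (2 * n) * a \<noteq> 0 \<and>
          qpoch q q i \<noteq> 0 \<and>
          qpoch (q powi (1 + int l - 2 * int n) / a) q i \<noteq> 0 \<and>
          qpoch (q powi (1 - int n) / a) q i \<noteq> 0 \<and>
          qpoch (q * a) (q ^ 3) ((int n - int i) div 3) \<noteq> 0 \<and>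
          qpoch (q ^ 2 * a) (q ^ 3) ((int n - int i) div 3) \<noteq> 0"
  shows
    "(\<Sum>k=0..n. qpoch a (q ^ 3) k *
        ((qpoch (q powi (- int n)) q k * qpoch (q powi (int n - int l) * a) q k) /
         (qpoch q q k * qpoch sqrt_a q k * qpoch (- sqrt_a) q k *
          qpoch (sqrt_q powi (1 - 2 * int l) * sqrt_a) q k *
          qpoch (- (sqrt_q * sqrt_a)) q k)) * q ^ k)
     = (qpoch (q powi (int n - int l) * a) q l *
        qpoch (sqrt_q powi (1 + 2 * int n - 2 * int l) * sqrt_a) q l) /
       (qpoch (q powi (2 * int n - int l) * a) q l *
        qpoch (sqrt_q powi (1 - 2 * int l) * sqrt_a) q l) *
       (\<Sum>i=0..l.
          sqrt_a powi ((2 * int n - 5 * int i) div 3) * sqrt_q ^ ((5 + 2 * l) * i) *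
          ((1 - q powi (2 * int n - 2 * int i) * a) / (1 - q ^ (2 * n) * a)) *
          ((qpoch (q powi (- int l)) q i * qpoch (q powi (- int n)) q i *
            qpoch (q powi (- 2 * int n) / a) q i) /
           (qpoch q q i * qpoch (q powi (1 + int l - 2 * int n) / a) q i *
            qpoch (q powi (1 - int n) / a) q i)) *
          ((qpoch q (q ^ 3) ((int n - int i) div 3) *
            qpoch (q ^ 2) (q ^ 3) ((int n - int i) div 3)) /
           (qpoch (q * a) (q ^ 3) ((int n - int i) div 3) *
            qpoch (q ^ 2 * a) (q ^ 3) ((int n - int i) div 3))) *
          chi (int n - int i))"
proof -
  let ?I = "{i. i \<le> l \<and> i \<le> n \<and> 3 dvd (n - i)}"
  have s: "sqrt_q \<noteq> 0" and t: "sqrt_a \<noteq> 0"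
    using a_nz q_nz sqrt_a sqrt_q by auto
  have pw: "q powi (- int m) = 1 / q ^ m" "q powi (int n - int l) = q ^ n / q ^ l"
    "sqrt_q powi (1 - 2 * int l) = sqrt_q / q ^ l"
    "sqrt_q powi (1 + 2 * int n - 2 * int l) = sqrt_q * q ^ n / q ^ l"
    "q powi (2 * int n - int l) = q ^ (2 * n) / q ^ l"
    "q powi (1 + int l - 2 * int n) / a = q * q ^ l / (q ^ (2 * n) * a)"
    "q powi (1 - int n) / a = q / (q ^ n * a)"
    "q powi (- 2 * int n) / a = 1 / (q ^ (2 * n) * a)"
    "q powi (2 * int n - 2 * int i) = q ^ (2 * n) / q ^ (2 * i)" for m i
    using s q_nz by (simp_all add: power_int_diff power_int_add power_int_minus sqrt_q divide_inverse
        power_int_mult power_mult)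
  \<comment> \<open>On \<open>?I\<close> truncated subtraction agrees with integer
    subtraction.\<close>
  have I: "3 dvd (int n - int i)" "(int n - int i) div 3 = int ((n - i) div 3)" if i: "i \<in> ?I" for i
  proof -
    obtain m where m: "n - i = 3 * m"
      using i by (blast elim: dvdE)
    then have "int n - int i = 3 * int m"
      using i by auto
    then show "3 dvd (int n - int i)" "(int n - int i) div 3 = int ((n - i) div 3)"
      using m by simp_all
  qed
  have trans: "(\<Sum>k\<le>n. qp a (q ^ 3) k * ((qp (1 / q ^ n) q k * qp (q ^ n / q ^ l * a) q k) /
      (qp q q k * qp sqrt_a q k * qp (- sqrt_a) q k * qp (sqrt_q / q ^ l * sqrt_a) q k * qp (- (sqrt_q * sqrt_a)) q k)) * q ^ k) =
    qp (q ^ n / q ^ l * a) q l * qp (sqrt_q * q ^ n / q ^ l * sqrt_a) q l /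
      (qp (q ^ (2 * n) / q ^ l * a) q l * qp (sqrt_q / q ^ l * sqrt_a) q l) *
    (\<Sum>i\<in>?I.
       (sqrt_q ^ (5 + 2 * l) / sqrt_a) ^ i * ((1 - q ^ (2 * n) / q ^ (2 * i) * a) / (1 - q ^ (2 * n) * a)) *
       (qp (1 / q ^ l) q i * qp (1 / q ^ n) q i * qp (1 / (q ^ (2 * n) * a)) q i /
         (qp q q i * qp (q * q ^ l / (q ^ (2 * n) * a)) q i * qp (q / (q ^ n * a)) q i)) *
       (a ^ ((n - i) div 3) * (qp q (q ^ 3) ((n - i) div 3) * qp (q ^ 2) (q ^ 3) ((n - i) div 3)) /
        (qp (q * a) (q ^ 3) ((n - i) div 3) * qp (q ^ 2 * a) (q ^ 3) ((n - i) div 3))))"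
  proof (rule cubic_transformation[OF s t sqrt_q [symmetric] sqrt_a [symmetric]])
    fix k assume "k \<le> n"
    then show "qp q q k \<noteq> 0 \<and> qp sqrt_a q k \<noteq> 0 \<and> qp (- sqrt_a) q k \<noteq> 0 \<and>
      qp (sqrt_q / q ^ l * sqrt_a) q k \<noteq> 0 \<and> qp (- (sqrt_q * sqrt_a)) q k \<noteq> 0"
      using lhs_denominators unfolding pw qpoch_nat by blast
  next
    show "qp (q ^ (2 * n) / q ^ l * a) q l \<noteq> 0" "qp (sqrt_q / q ^ l * sqrt_a) q l \<noteq> 0"
      using prefactor_denominators unfolding pw qpoch_nat by blast+
  next
    fix i assume "i \<le> l" "i \<le> n" "3 dvd (n - i)"
    then have i: "i \<in> ?I" by blast
    show "1 - q ^ (2 * n) * a \<noteq> 0 \<and> qp q q i \<noteq> 0 \<and> qp (q * q ^ l / (q ^ (2 * n) * a)) q i \<noteq> 0 \<and>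
      qp (q / (q ^ n * a)) q i \<noteq> 0 \<and> qp (q * a) (q ^ 3) ((n - i) div 3) \<noteq> 0 \<and>
      qp (q ^ 2 * a) (q ^ 3) ((n - i) div 3) \<noteq> 0"
      using rhs_denominators[OF \<open>i \<le> l\<close> I(1)[OF i]] unfolding pw I(2)[OF i] qpoch_nat .
  qed
  \<comment> \<open>With n - i = 3m the exponent (2n - 5i)/3 is 2m - i, so the power of
    \<open>sqrt_a\<close> splits into a^m and \<open>sqrt_a\<close>^(-i).\<close>
  have root: "sqrt_a powi ((2 * int n - 5 * int i) div 3) * sqrt_q ^ ((5 + 2 * l) * i) =
      (sqrt_q ^ (5 + 2 * l) / sqrt_a) ^ i * a ^ ((n - i) div 3)" if "i \<in> ?I" for i
  proof -
    define m where "m = (n - i) div 3"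
    have "n = 3 * m + i"
      using that by (auto simp: m_def)
    then have "(2 * int n - 5 * int i) div 3 = 2 * int m - int i"
      by simp
    then have "sqrt_a powi ((2 * int n - 5 * int i) div 3) = a ^ m / sqrt_a ^ i"
      using t by (simp add: power_int_diff power_int_mult sqrt_a)
    then show ?thesis
      unfolding m_def by (simp only: power_divide power_mult) simp
  qed
  define f where "f i = sqrt_a powi ((2 * int n - 5 * int i) div 3) * sqrt_q ^ ((5 + 2 * l) * i) *
          ((1 - q powi (2 * int n - 2 * int i) * a) / (1 - q ^ (2 * n) * a)) *
          ((qpoch (q powi (- int l)) q i * qpoch (q powi (- int n)) q i *
            qpoch (q powi (- 2 * int n) / a) q i) /
           (qpoch q q i * qpoch (q powi (1 + int l - 2 * int n) / a) q i *
            qpoch (q powi (1 - int n) / a) q i)) *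
          ((qpoch q (q ^ 3) ((int n - int i) div 3) *
            qpoch (q ^ 2) (q ^ 3) ((int n - int i) div 3)) /
           (qpoch (q * a) (q ^ 3) ((int n - int i) div 3) *
            qpoch (q ^ 2 * a) (q ^ 3) ((int n - int i) div 3))) *
          chi (int n - int i)" for i :: nat
  have "(\<Sum>i=0..l. f i) = (\<Sum>i\<in>?I. f i)"
  proof (rule sum.mono_neutral_right)
    show "\<forall>i\<in>{0..l} - ?I. f i = 0"
    proof
      fix i assume i: "i \<in> {0..l} - ?I"
      show "f i = 0"
      proof (cases "i \<le> n")
        case True
        then have "int n - int i = int (n - i)" "\<not> 3 dvd (n - i)"
          using i by auto
        then have "chi (int n - int i) = 0"
          unfolding chi_def by presburger
        then show ?thesis
          by (simp add: f_def)
      next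
        \<comment> \<open>For i > n the factor (q^(-n);q)_i is zero and annihilates the summand,
          whatever values the factorials with negative index (n - i) div 3 take.\<close>
        case False
        then have "qpoch (q powi (- int n)) q i = 0"
          using q_nz by (simp add: pw qpoch_nat qp_inverse_power_eq_0)
        then show ?thesis
          by (simp add: f_def)
      qed
    qed
  qed auto
  also have "\<dots> = (\<Sum>i\<in>?I.
       (sqrt_q ^ (5 + 2 * l) / sqrt_a) ^ i * ((1 - q ^ (2 * n) / q ^ (2 * i) * a) / (1 - q ^ (2 * n) * a)) *
       (qp (1 / q ^ l) q i * qp (1 / q ^ n) q i * qp (1 / (q ^ (2 * n) * a)) q i /
         (qp q q i * qp (q * q ^ l / (q ^ (2 * n) * a)) q i * qp (q / (q ^ n * a)) q i)) *
       (a ^ ((n - i) div 3) * (qp q (q ^ 3) ((n - i) div 3) * qp (q ^ 2) (q ^ 3) ((n - i) div 3)) /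
        (qp (q * a) (q ^ 3) ((n - i) div 3) * qp (q ^ 2 * a) (q ^ 3) ((n - i) div 3))))"
  proof (rule sum.cong [OF refl])
    fix i assume i: "i \<in> ?I"
    have "chi (int n - int i) = 1"
      using I(1)[OF i] by (simp add: chi_def)
    then show "f i = (sqrt_q ^ (5 + 2 * l) / sqrt_a) ^ i * ((1 - q ^ (2 * n) / q ^ (2 * i) * a) / (1 - q ^ (2 * n) * a)) *
       (qp (1 / q ^ l) q i * qp (1 / q ^ n) q i * qp (1 / (q ^ (2 * n) * a)) q i /
         (qp q q i * qp (q * q ^ l / (q ^ (2 * n) * a)) q i * qp (q / (q ^ n * a)) q i)) *
       (a ^ ((n - i) div 3) * (qp q (q ^ 3) ((n - i) div 3) * qp (q ^ 2) (q ^ 3) ((n - i) div 3)) /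
        (qp (q * a) (q ^ 3) ((n - i) div 3) * qp (q ^ 2 * a) (q ^ 3) ((n - i) div 3)))"
      unfolding f_def root[OF i] pw I(2)[OF i] qpoch_nat by simp
  qed
  finally show ?thesis
    using trans unfolding f_def pw qpoch_nat atLeast0AtMost by simp
qed

end
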